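(* Consider the split system $g(p,x)=(g_1(p,x),g_2(p,x))\in C_1\times C_2=C$ with $g_i:P\times\mathbb{R}^n\to\mathbb{R}^{l_i}$, closed $C_i\subset\mathbb{R}^{l_i}$, $l_1+l_2=l$, satisfying the standing assumptions at $(\bar p,\bar x)\in\operatorname{gph}\Gamma$. Let $\zeta:P\to\mathbb{R}$ be continuous at $\bar p$ and let $D:=D^{\mathrm{Im}}_{p,\zeta}g(\bar p,\bar x)$. Assume: (a) for every $v\in D$ and every sequence $t_k\downarrow0$ there is $u\in\mathbb{R}^n$ with $\liminf_{k\to\infty}\operatorname{dist}\big(g(\bar p,\bar x)+t_k(v+\nabla_xg(\bar p,\bar x)u);C\big)/t_k=0$; (b) Robinson stability holds at $(\bar p,\bar x)$ for the subsystem $g_2(p,x)\in C_2$; (c) for every $(v,u)\in D\times\mathbb{R}^n$ with $(v,u)\neq(0,0)$ and $v+\nabla_xg(\bar p,\bar x)u\in T_C(g(\bar p,\bar x))$, writing $v=(v_1,v_2)\in\mathbb{R}^{l_1}\times\mathbb{R}^{l_2}$, the implication $$\Big[\lambda=(\lambda^1,\lambda^2)\in\prod_{i=1}^2N_{C_i}\big(g_i(\bar p,\bar x);v_i+\nabla_xg_i(\bar p,\bar x)u\big),\ \nabla_xg(\bar p,\bar x)^T\lambda=0\Big]\Longrightarrow\lambda^1=0$$ holds. Then Robinson stability holds at $(\bar p,\bar x)$ for the whole system $g(p,x)\in C$.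
   Context: $P$ is a topological space, $\Gamma(p)=\{x:g(p,x)\in C\}$. Standing assumptions: there are neighborhoods $U$ of $\bar x$ and $V$ of $\bar p$ such that for each $p\in V$ the map $g(p,\cdot)$ is continuously differentiable on $U$, and $g$, $\nabla_x g$ are continuous at $(\bar p,\bar x)$. Robinson stability of a system $h(p,x)\in K$ at $(\bar p,\bar x)$: there exist $\kappa\ge0$ and neighborhoods $U$ of $\bar x$, $V$ of $\bar p$ with $\operatorname{dist}(x;\{\xi:h(p,\xi)\in K\})\le\kappa\operatorname{dist}(h(p,x);K)$ for all $(p,x)\in V\times U$. Image derivative $D^{\mathrm{Im}}_{p,\zeta}g(\bar p,\bar x)$: the smallest closed cone containing $0$ and all $v\in\mathbb{R}^l$ for which there is a sequence $p_k\in P$ with $0<\|g(p_k,\bar x)-g(\bar p,\bar x)\|<1/k$, $\|\nabla_xg(p_k,\bar x)-\nabla_xg(\bar p,\bar x)\|<1/k$, $|\zeta(p_k)-\zeta(\bar p)|<1/k$ and $v=\lim_k (g(p_k,\bar x)-g(\bar p,\bar x))/\|g(p_k,\bar x)-g(\bar p,\bar x)\|$. $T_C$ is the contingent cone. Directional limiting normal cone of a closed set $\Omega$ at $\bar z$ in direction $w$: $N_\Omega(\bar z;w)=\{v:\exists t_k\downarrow0,w_k\to w,v_k\to v,\ \bar z+t_kw_k\in\Omega,\ v_k\in\widehat N_\Omega(\bar z+t_kw_k)\}$, where $\widehat N_\Omega(z)$ is the regular (Fréchet) normal cone (polar of the contingent cone). *)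

theory Defs
  imports "HOL-Analysis.Analysis" "HOL-Library.Liminf_Limsup"
begin

text \<open>Robinson stability of the system h(p,x) \<in> K at (pb,xb). The distance to the empty
  set is +\<infinity> in the paper; since infdist to the empty set is 0 in Isabelle, we require
  explicitly that the feasible set be nonempty whenever K is nonempty (if K is empty both
  sides are +\<infinity> and the inequality holds trivially).\<close>
definition robinson_stable ::
  "('p::topological_space \<Rightarrow> 'x::metric_space \<Rightarrow> 'y::metric_space) \<Rightarrow> 'y set \<Rightarrow> 'p \<Rightarrow> 'x \<Rightarrow> bool" where
  "robinson_stable h K pb xb \<longleftrightarrow>
     (\<exists>\<kappa>\<ge>0. \<exists>U V. open U \<and> xb \<in> U \<and> open V \<and> pb \<in> V \<and>
        (\<forall>p\<in>V. \<forall>x\<in>U. (K \<noteq> {} \<longrightarrow> {\<xi>. h p \<xi> \<in> K} \<noteq> {}) \<and>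
            infdist x {\<xi>. h p \<xi> \<in> K} \<le> \<kappa> * infdist (h p x) K))"

text \<open>Continuity at a point of a map on a general topological space is written as
  convergence to the value along at (library continuous needs a T2 domain). Standing assumptions: Dg p x is the partial derivative \<nabla>_x g(p,x).\<close>
definition standing_assumptions ::
  "('p::topological_space \<Rightarrow> 'x::euclidean_space \<Rightarrow> 'y::euclidean_space) \<Rightarrow>
   ('p \<Rightarrow> 'x \<Rightarrow> ('x \<Rightarrow>\<^sub>L 'y)) \<Rightarrow> 'p \<Rightarrow> 'x \<Rightarrow> bool" where
  "standing_assumptions g Dg pb xb \<longleftrightarrow>
     (\<exists>U V. open U \<and> xb \<in> U \<and> open V \<and> pb \<in> V \<and>
        (\<forall>p\<in>V. (\<forall>x\<in>U. (g p has_derivative blinfun_apply (Dg p x)) (at x)) \<and>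
                 continuous_on U (Dg p))) \<and>
     ((\<lambda>z. g (fst z) (snd z)) \<longlongrightarrow> g pb xb) (at (pb, xb)) \<and>
     ((\<lambda>z. Dg (fst z) (snd z)) \<longlongrightarrow> Dg pb xb) (at (pb, xb))"

text \<open>Image derivative D^Im_{p,\<zeta>} g(pb,xb): smallest closed cone containing 0 and the
  set of limit directions (indices k = Suc j, so 1/k becomes 1/(Suc j)).\<close>
definition img_dir_set ::
  "('p \<Rightarrow> 'x \<Rightarrow> 'y::real_normed_vector) \<Rightarrow> ('p \<Rightarrow> 'x \<Rightarrow> ('x::real_normed_vector \<Rightarrow>\<^sub>L 'y)) \<Rightarrow>
   ('p \<Rightarrow> real) \<Rightarrow> 'p \<Rightarrow> 'x \<Rightarrow> 'y set" where
  "img_dir_set g Dg \<zeta> pb xb = {v. \<exists>pk :: nat \<Rightarrow> 'p.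
      (\<forall>k. 0 < norm (g (pk k) xb - g pb xb) \<and> norm (g (pk k) xb - g pb xb) < 1 / real (Suc k) \<and>
           norm (Dg (pk k) xb - Dg pb xb) < 1 / real (Suc k) \<and>
           \<bar>\<zeta> (pk k) - \<zeta> pb\<bar> < 1 / real (Suc k)) \<and>
      ((\<lambda>k. (1 / norm (g (pk k) xb - g pb xb)) *\<^sub>R (g (pk k) xb - g pb xb)) \<longlonglongrightarrow> v)}"

definition img_deriv ::
  "('p \<Rightarrow> 'x \<Rightarrow> 'y::real_normed_vector) \<Rightarrow> ('p \<Rightarrow> 'x \<Rightarrow> ('x::real_normed_vector \<Rightarrow>\<^sub>L 'y)) \<Rightarrow>
   ('p \<Rightarrow> real) \<Rightarrow> 'p \<Rightarrow> 'x \<Rightarrow> 'y set" where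
  "img_deriv g Dg \<zeta> pb xb =
     \<Inter>{K. cone K \<and> closed K \<and> 0 \<in> K \<and> img_dir_set g Dg \<zeta> pb xb \<subseteq> K}"

definition contingent_cone :: "'a::real_normed_vector set \<Rightarrow> 'a \<Rightarrow> 'a set" where
  "contingent_cone C z = {w. \<exists>t wk. (\<forall>k. 0 < (t::nat \<Rightarrow> real) k) \<and> decseq t \<and> t \<longlonglongrightarrow> 0 \<and>
      wk \<longlonglongrightarrow> w \<and> (\<forall>k. z + t k *\<^sub>R wk k \<in> C)}"

definition regular_normal_cone :: "'a::real_inner set \<Rightarrow> 'a \<Rightarrow> 'a set" where
  "regular_normal_cone C z = {v. \<forall>w\<in>contingent_cone C z. inner v w \<le> 0}"

definition dir_normal_cone :: "'a::real_inner set \<Rightarrow> 'a \<Rightarrow> 'a \<Rightarrow> 'a set" where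
  "dir_normal_cone \<Omega> z w = {v. \<exists>t wk vk. (\<forall>k. 0 < (t::nat \<Rightarrow> real) k) \<and> decseq t \<and> t \<longlonglongrightarrow> 0 \<and>
      wk \<longlonglongrightarrow> w \<and> vk \<longlonglongrightarrow> v \<and>
      (\<forall>k. z + t k *\<^sub>R wk k \<in> \<Omega> \<and> vk k \<in> regular_normal_cone \<Omega> (z + t k *\<^sub>R wk k))}"

end

theory Submission
  imports Defs
begin

text \<open>Argue by contradiction. If the estimate fails, there are points \<open>x\<close> near \<open>xb\<close> and parameters
  \<open>p\<close> near \<open>pb\<close> whose distance to the feasible set is much larger than the residual. Around such
  a point without feasible points nearby, minimise the distance of the first component to
  \<open>C1\<close> plus a small quadratic localisation term and a large multiple of the squared distance of the
  second component to \<open>C2\<close>. Stability of the second subsystem bounds the resulting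
  multiplier of \<open>C2\<close>, while the multiplier of \<open>C1\<close> has norm one because the minimiser is
  infeasible. If the residual is small compared with
  \<open>norm (g p xb - g pb xb) + norm (x - xb)\<close>, rescaling by this quantity and passing to the limit
  contradicts (c). If it is not, then (a) provides a point near \<open>xb\<close> whose residual is small in
  this sense; the feasible point close to it given by the first case is also close enough
  to \<open>x\<close>.\<close>

section \<open>Multipliers from a penalised minimisation\<close>

lemma infdist_attained:
  fixes C :: "'a::heine_borel set"
  assumes "closed C" "C \<noteq> {}"
  obtains c where "c \<in> C" "dist z c = infdist z C"
proof -
  obtain c where c: "c \<in> C" "\<And>y. y \<in> C \<Longrightarrow> dist z c \<le> dist z y"
    using distance_attains_inf[OF assms] by metis
  have "dist z c \<le> infdist z C"
    unfolding infdist_notempty[OF assms(2)] using assms(2) c(2) by (intro cINF_greatest) auto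
  then show ?thesis using that c(1) infdist_le[OF c(1), of z] by fastforce
qed

lemma infdist_Times_le:
  assumes "closed C1" "closed C2" "C1 \<noteq> {}" "C2 \<noteq> {}"
  fixes z :: "'a::euclidean_space \<times> 'b::euclidean_space"
  shows "infdist (fst z) C1 \<le> infdist z (C1 \<times> C2)" "infdist (snd z) C2 \<le> infdist z (C1 \<times> C2)"
proof -
  have "closed (C1 \<times> C2)" "C1 \<times> C2 \<noteq> {}" using assms by (auto intro: closed_Times)
  then obtain c where c: "c \<in> C1 \<times> C2" "dist z c = infdist z (C1 \<times> C2)"
    using infdist_attained by blast
  have "dist (fst z) (fst c) \<le> dist z c" "dist (snd z) (snd c) \<le> dist z c"
    by (rule dist_fst_le dist_snd_le)+
  moreover have "fst c \<in> C1" "snd c \<in> C2" using c by auto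
  ultimately show "infdist (fst z) C1 \<le> infdist z (C1 \<times> C2)"
    "infdist (snd z) C2 \<le> infdist z (C1 \<times> C2)"
    using c(2) by (metis infdist_le2)+
qed

text \<open>A nearest point \<open>c\<close> stays nearest when compared with
  \<open>c + t k *\<^sub>R wk k\<close>. Expanding the squared norms and dividing by
  \<open>t k\<close> leaves an error \<open>t k * (norm (wk k))\<^sup>2\<close>, which vanishes in
  the limit.\<close>

lemma proximal_normal_regular:
  fixes C :: "'a::euclidean_space set"
  assumes c: "c \<in> C" "dist z c = infdist z C" and a: "a \<ge> 0"
  shows "a *\<^sub>R (z - c) \<in> regular_normal_cone C c"
  unfolding regular_normal_cone_def
proof (intro CollectI ballI)
  fix w assume "w \<in> contingent_cone C c"
  then obtain t wk where t: "\<And>k. 0 < (t::nat \<Rightarrow> real) k" "t \<longlonglongrightarrow> 0" "wk \<longlonglongrightarrow> w"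
    "\<And>k. c + t k *\<^sub>R wk k \<in> C"
    unfolding contingent_cone_def by auto
  have "2 * inner (z - c) (wk k) \<le> t k * (norm (wk k))\<^sup>2" for k
  proof -
    have "norm (z - c) \<le> norm ((z - c) - t k *\<^sub>R wk k)"
      using infdist_le[OF t(4), of z k] c(2) by (simp add: dist_norm algebra_simps)
    then have "(norm (z - c))\<^sup>2 \<le> (norm ((z - c) - t k *\<^sub>R wk k))\<^sup>2"
      by (simp add: power_mono)
    also have "\<dots> = (norm (z - c))\<^sup>2 + t k * (t k * (norm (wk k))\<^sup>2 - 2 * inner (z - c) (wk k))"
      unfolding power2_norm_eq_inner by (simp add: inner_diff inner_commute algebra_simps)
    finally have "0 \<le> t k * (t k * (norm (wk k))\<^sup>2 - 2 * inner (z - c) (wk k))" by simp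
    with t(1)[of k] show ?thesis by (simp add: zero_le_mult_iff)
  qed
  moreover have "(\<lambda>k. 2 * inner (z - c) (wk k)) \<longlonglongrightarrow> 2 * inner (z - c) w"
    by (intro tendsto_intros t)
  moreover have "(\<lambda>k. t k * (norm (wk k))\<^sup>2) \<longlonglongrightarrow> 0 * (norm w)\<^sup>2"
    by (intro tendsto_intros t)
  ultimately have "2 * inner (z - c) w \<le> 0 * (norm w)\<^sup>2"
    using LIMSEQ_le by blast
  then show "inner (a *\<^sub>R (z - c)) w \<le> 0"
    using a by (simp add: mult_nonneg_nonpos)
qed

text \<open>The multipliers come from Fermat's rule at the minimiser \<open>y\<close>.
  \<open>l1\<close> is a unit vector, being the gradient of a distance at a point off
  \<open>C1\<close>. \<open>l2\<close> stays bounded because hypothesis \<open>K\<close> removes the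
  second residual by a move proportional to it. The stationarity defect is the gradient of the
  localisation term, of order \<open>d / r\<close>.\<close>

lemma penalty_multipliers:
  fixes f :: "'a::euclidean_space \<Rightarrow> 'b::euclidean_space \<times> 'c::euclidean_space"
    and D :: "'a \<Rightarrow> 'a \<Rightarrow>\<^sub>L ('b \<times> 'c)"
  assumes C1: "closed C1" "C1 \<noteq> {}" and C2: "closed C2" "C2 \<noteq> {}"
    and r: "0 < r"
    and der: "\<And>y. y \<in> cball x r \<Longrightarrow> (f has_derivative blinfun_apply (D y)) (at y)"
    and L: "0 \<le> L" "\<And>y. y \<in> cball x r \<Longrightarrow> norm (D y) \<le> L"
    and K: "0 \<le> K" "\<And>y. y \<in> cball x r \<Longrightarrow>
        \<exists>y'. snd (f y') \<in> C2 \<and> dist y y' \<le> K * infdist (snd (f y)) C2"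
    and infeas: "\<And>y. y \<in> cball x r \<Longrightarrow> f y \<notin> C1 \<times> C2"
    and d_def: "d = infdist (f x) (C1 \<times> C2)"
    and small: "4 * K * d \<le> r" "(1 + L * K) * d \<le> r"
  shows "\<exists>y c1 c2 l1 l2. dist x y \<le> r \<and> c1 \<in> C1 \<and> c2 \<in> C2 \<and>
      dist (fst (f y)) c1 \<le> (1 + L * K) * d \<and> dist (snd (f y)) c2 \<le> (1 + L * K) * d \<and>
      l1 \<in> regular_normal_cone C1 c1 \<and> l2 \<in> regular_normal_cone C2 c2 \<and>
      norm l1 = 1 \<and> norm l2 \<le> 2 * K * (L + 10) \<and>
      (\<forall>h. \<bar>inner (l1, l2) (D y h)\<bar> \<le> 5 * (1 + L * K) * (d / r) * norm h)"
proof -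
  define d' where "d' = (1 + L * K) * d"
  have d0: "0 \<le> d" by (simp add: d_def infdist_nonneg)
  have "closed (C1 \<times> C2)" using C1 C2 by (simp add: closed_Times)
  then have dpos: "0 < d"
    using infdist_pos_not_in_closed[of "C1 \<times> C2" "f x"] C1 C2 infeas[of x] r by (simp add: d_def)
  have d'pos: "0 < d'" unfolding d'_def using dpos L K
    by (intro mult_pos_pos add_pos_nonneg) auto
  have d'r: "d' \<le> r" using small d'_def by simp
  have xB: "x \<in> cball x r" using r by simp
  have lip: "dist (f y) (f z) \<le> L * dist y z" if "y \<in> cball x r" "z \<in> cball x r" for y z
    unfolding dist_norm
    using differentiable_bound[of "cball x r" f "\<lambda>y. blinfun_apply (D y)" L y z] that der L
    by (simp add: norm_blinfun.rep_eq has_derivative_at_withinI)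
  have dist1: "infdist (fst (f z)) C1 \<le> infdist (fst (f y)) C1 + L * dist y z"
    if "y \<in> cball x r" "z \<in> cball x r" for y z
    using infdist_triangle[of "fst (f z)" C1 "fst (f y)"] dist_fst_le[of "f y" "f z"]
      lip[OF that] by (simp add: dist_commute)
  have cont: "continuous_on (cball x r) f"
    using der by (meson continuous_at_imp_continuous_on has_derivative_continuous)
  note dle = infdist_Times_le[OF C1(1) C2(1) C1(2) C2(2), of "f x"]
  \<comment> \<open>\<open>x2\<close> satisfies the second constraint and will centre the
    localisation term, so \<open>F x2\<close> reduces to the first residual. Moving from
    \<open>x\<close> to \<open>x2\<close> raises that residual by at most \<open>L * K * d\<close>,
    which explains \<open>d'\<close>.\<close>
  obtain x2 where x2: "snd (f x2) \<in> C2" "dist x x2 \<le> K * infdist (snd (f x)) C2"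
    using K(2)[OF xB] by blast
  have xx2: "dist x x2 \<le> K * d"
    using x2(2) mult_left_mono[OF dle(2) K(1)] d_def by simp
  have x2r: "dist x x2 \<le> r / 4" using xx2 small by simp
  have x2B: "x2 \<in> cball x r" using x2r r by simp
  have f1x2: "infdist (fst (f x2)) C1 \<le> d'"
    using dist1[OF xB x2B] dle(1) mult_left_mono[OF xx2 L(1)] unfolding d_def d'_def
    by (simp add: algebra_simps)
  define R where "R = (\<lambda>y. infdist (fst (f y)) C1 + infdist (snd (f y)) C2)"
  have contR: "continuous_on (cball x r) R"
    unfolding R_def by (intro continuous_intros cont)
  \<comment> \<open>Compactness turns infeasibility on the ball into a positive lower bound
    \<open>m\<close> for the sum of the residuals.\<close>
  obtain y0 where y0: "y0 \<in> cball x r" "\<And>y. y \<in> cball x r \<Longrightarrow> R y0 \<le> R y"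
    using continuous_attains_inf[OF compact_cball _ contR] r by fastforce
  define m where "m = R y0"
  have mpos: "0 < m"
  proof -
    have "fst (f y0) \<notin> C1 \<or> snd (f y0) \<notin> C2"
      using infeas[OF y0(1)] by (metis mem_Times_iff)
    then show ?thesis
      using infdist_pos_not_in_closed[OF C1(1,2), of "fst (f y0)"]
        infdist_pos_not_in_closed[OF C2(1,2), of "snd (f y0)"]
        infdist_nonneg[of "fst (f y0)" C1] infdist_nonneg[of "snd (f y0)" C2]
      unfolding m_def R_def by linarith
  qed
  \<comment> \<open>The penalty \<open>j\<close> makes the second residual at the minimiser \<open>y\<close> at most \<open>e\<close>: below \<open>m\<close>, so that
    the first residual stays positive at \<open>y\<close>, and small enough that the point \<open>y2\<close>
    supplied for \<open>y\<close> by hypothesis \<open>K\<close> stays in the ball.\<close>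
  define e where "e = min (m / 2) (min d' (r / (4 * (K + 1))))"
  have epos: "0 < e" unfolding e_def using mpos d'pos r K by simp
  define j where "j = d' / e\<^sup>2"
  have jpos: "0 < j" unfolding j_def using epos d'pos by simp
  \<comment> \<open>\<open>\<sigma>\<close> is large enough to keep \<open>y\<close> off the boundary, yet the gradient of that term stays \<open>O(d / r)\<close>.\<close>
  define \<sigma> where "\<sigma> = 5 * d' / r\<^sup>2"
  have \<sigma>pos: "0 < \<sigma>" unfolding \<sigma>_def using r d'pos by simp
  define F where "F = (\<lambda>y. infdist (fst (f y)) C1 + \<sigma> * (dist y x2)\<^sup>2 + j * (infdist (snd (f y)) C2)\<^sup>2)"
  have contF: "continuous_on (cball x r) F"
    unfolding F_def by (intro continuous_intros cont)
  obtain y where y: "y \<in> cball x r" "\<And>z. z \<in> cball x r \<Longrightarrow> F y \<le> F z"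
    using continuous_attains_inf[OF compact_cball _ contF] r by fastforce
  define e2 where "e2 = infdist (snd (f y)) C2"
  define e1 where "e1 = infdist (fst (f y)) C1"
  have e12: "0 \<le> e1" "0 \<le> e2" by (simp_all add: e1_def e2_def infdist_nonneg)
  have "F x2 = infdist (fst (f x2)) C1" using x2(1) by (simp add: F_def)
  then have "F y \<le> d'" using y(2)[OF x2B] f1x2 by linarith
  then have Fy: "e1 + \<sigma> * (dist y x2)\<^sup>2 + j * e2\<^sup>2 \<le> d'"
    unfolding F_def e1_def e2_def .
  have n1: "0 \<le> \<sigma> * (dist y x2)\<^sup>2" "0 \<le> j * e2\<^sup>2" using \<sigma>pos jpos by auto
  have e1d: "e1 \<le> d'" using Fy n1 by linarith
  \<comment> \<open>Any factor above 4 in \<open>\<sigma>\<close> would do: it puts \<open>y\<close>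
    within \<open>r / 2\<close> of \<open>x2\<close>, hence within \<open>3 * r / 4\<close> of
    \<open>x\<close>.\<close>
  have "\<sigma> * (dist y x2)\<^sup>2 \<le> d'" using Fy n1 e12 by linarith
  then have "(dist y x2)\<^sup>2 \<le> r\<^sup>2 / 5" using d'pos r
    by (simp add: \<sigma>_def field_simps)
  also have "\<dots> < (r / 2)\<^sup>2" using r by (simp add: power2_eq_square)
  finally have yx2: "dist y x2 < r / 2"
    using r by (meson half_gt_zero less_le_not_le power_less_imp_less_base)
  have yint: "y \<in> ball x r"
    using yx2 x2r dist_triangle[of x y x2] r by (simp add: dist_commute)
  have "j * e2\<^sup>2 \<le> d'" using Fy n1 e12 by linarith
  then have "e2\<^sup>2 \<le> e\<^sup>2" using d'pos epos by (simp add: j_def field_simps)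
  then have e2e: "e2 \<le> e" using epos power2_le_imp_le by fastforce
  have e2d: "e2 \<le> d'" using e2e e_def by simp
  have "m \<le> e1 + e2" using y0(2)[OF y(1)] by (simp add: R_def m_def e1_def e2_def)
  moreover have "e \<le> m / 2" unfolding e_def by (rule min.cobounded1)
  ultimately have e1pos: "0 < e1" using e2e mpos by linarith
  \<comment> \<open>Comparing \<open>F y\<close> with \<open>F y2\<close>, where the penalty vanishes, bounds the multiplier \<open>2 * j * e2\<close>
    independently of \<open>j\<close>.\<close>
  have je2: "j * e2 \<le> K * (L + 10)"
  proof (cases "e2 = 0")
    case True then show ?thesis using K L by simp
  next
    case False
    then have e2pos: "0 < e2" using e12 by simp
    obtain y2 where y2: "snd (f y2) \<in> C2" "dist y y2 \<le> K * e2"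
      using K(2)[OF y(1)] unfolding e2_def by blast
    have "K * e2 \<le> (K + 1) * (r / (4 * (K + 1)))"
      using e2e e12 K unfolding e_def by (intro mult_mono) auto
    also have "\<dots> = r / 4" using K by (simp add: field_simps)
    finally have Ke: "K * e2 \<le> r / 4" .
    have y2B: "y2 \<in> cball x r"
      using Ke y2(2) yx2 x2r dist_triangle[of x y x2] dist_triangle[of x y2 y] by (simp add: dist_commute)
    have "dist y2 x2 \<le> dist y x2 + K * e2" "dist y2 x2 \<le> r"
      using dist_triangle[of y2 x2 y] y2(2) Ke yx2 r by (simp_all add: dist_commute)
    moreover have "dist y x2 \<le> r" using yx2 r by simp
    ultimately have "(dist y2 x2)\<^sup>2 - (dist y x2)\<^sup>2 \<le> K * e2 * (2 * r)"
    proof -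
      have "(dist y2 x2)\<^sup>2 - (dist y x2)\<^sup>2 = (dist y2 x2 - dist y x2) * (dist y2 x2 + dist y x2)"
        by (simp add: power2_eq_square algebra_simps)
      also have "\<dots> \<le> (K * e2) * (2 * r)"
        using \<open>dist y2 x2 \<le> dist y x2 + K * e2\<close> \<open>dist y2 x2 \<le> r\<close> \<open>dist y x2 \<le> r\<close> K e12
        by (intro mult_mono) auto
      finally show ?thesis .
    qed
    \<comment> \<open>The 10 in the bound on \<open>l2\<close> arises here: the localisation term
      changes at rate at most \<open>2 * r * \<sigma> = 10 * d' / r\<close>, and
      \<open>d' \<le> r\<close>.\<close>
    then have "\<sigma> * ((dist y2 x2)\<^sup>2 - (dist y x2)\<^sup>2) \<le> \<sigma> * (K * e2 * (2 * r))"
      using \<sigma>pos by (intro mult_left_mono) auto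
    also have "\<dots> = 10 * (d' / r) * K * e2"
      using r by (simp add: \<sigma>_def power2_eq_square)
    also have "\<dots> \<le> 10 * 1 * K * e2"
      using d'r r K e12 d'pos by (intro mult_right_mono) (auto simp: field_simps)
    finally have s1: "\<sigma> * (dist y2 x2)\<^sup>2 - \<sigma> * (dist y x2)\<^sup>2 \<le> 10 * K * e2"
      by (simp add: algebra_simps)
    have "F y \<le> F y2" using y(2) y2B by simp
    moreover have "infdist (fst (f y2)) C1 \<le> e1 + L * (K * e2)"
      using dist1[OF y(1) y2B] mult_left_mono[OF y2(2) L(1)] by (simp add: e1_def)
    ultimately have "j * e2\<^sup>2 \<le> L * (K * e2) + 10 * K * e2"
      using s1 y2(1) unfolding F_def e1_def[symmetric] e2_def[symmetric] by simp
    then have "(j * e2) * e2 \<le> (K * (L + 10)) * e2"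
      by (simp add: algebra_simps power2_eq_square)
    then show ?thesis using e2pos by (simp add: mult_le_cancel_right)
  qed
  obtain c1 where c1: "c1 \<in> C1" "dist (fst (f y)) c1 = infdist (fst (f y)) C1"
    using infdist_attained[OF C1] by blast
  obtain c2 where c2: "c2 \<in> C2" "dist (snd (f y)) c2 = infdist (snd (f y)) C2"
    using infdist_attained[OF C2] by blast
  define l1 where "l1 = (1 / e1) *\<^sub>R (fst (f y) - c1)"
  define l2 where "l2 = (2 * j) *\<^sub>R (snd (f y) - c2)"
  have nz: "fst (f y) - c1 \<noteq> 0" using c1 e1pos e1_def by auto
  have nrm1: "norm (fst (f y) - c1) = e1" using c1 by (simp add: dist_norm e1_def)
  have nrm2: "norm (snd (f y) - c2) = e2" using c2 by (simp add: dist_norm e2_def)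
  \<comment> \<open>Freezing the projections \<open>c1\<close> and \<open>c2\<close> gives a
    majorant of \<open>F\<close> that touches it at \<open>y\<close>, so \<open>y\<close> also
    minimises \<open>H\<close> on the ball. \<open>H\<close> is differentiable at \<open>y\<close>
    because \<open>e1 > 0\<close> keeps the argument of the norm nonzero.\<close>
  define H where "H = (\<lambda>z. norm (fst (f z) - c1) + \<sigma> * inner (z - x2) (z - x2)
      + j * inner (snd (f z) - c2) (snd (f z) - c2))"
  have HF: "F z \<le> H z" for z
  proof -
    have "(infdist (snd (f z)) C2)\<^sup>2 \<le> (dist (snd (f z)) c2)\<^sup>2"
      using infdist_le[OF c2(1)] infdist_nonneg by (intro power_mono) auto
    then show ?thesis
      using infdist_le[OF c1(1), of "fst (f z)"] jpos
      unfolding F_def H_def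
      by (simp add: dist_norm power2_norm_eq_inner add_mono mult_left_mono)
  qed
  have Hy: "H y = F y"
    unfolding F_def H_def using c1 c2 by (simp add: dist_norm flip: power2_norm_eq_inner)
  have fd: "(f has_derivative blinfun_apply (D y)) (at y)" using der y(1) by simp
  have f1d: "((\<lambda>z. fst (f z) - c1) has_derivative (\<lambda>h. fst (D y h))) (at y)"
    using fd by (auto intro!: derivative_eq_intros)
  have f2d: "((\<lambda>z. snd (f z) - c2) has_derivative (\<lambda>h. snd (D y h))) (at y)"
    using fd by (auto intro!: derivative_eq_intros)
  have xd: "((\<lambda>z. z - x2) has_derivative (\<lambda>h. h)) (at y)"
    by (auto intro!: derivative_eq_intros)
  have n: "((\<lambda>z. norm (fst (f z) - c1)) has_derivative
      (\<lambda>h. inner (fst (D y h)) (sgn (fst (f y) - c1)))) (at y)"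
    using has_derivative_compose[OF f1d has_derivative_norm[OF nz]] by (simp add: inner_commute)
  have Hd: "(H has_derivative (\<lambda>h. inner (fst (D y h)) (sgn (fst (f y) - c1))
      + \<sigma> * (inner (y - x2) h + inner h (y - x2))
      + j * (inner (snd (f y) - c2) (snd (D y h)) + inner (snd (D y h)) (snd (f y) - c2)))) (at y)"
    unfolding H_def
    using has_derivative_add[OF has_derivative_add[OF n has_derivative_mult_right[OF has_derivative_inner[OF xd xd]]]
        has_derivative_mult_right[OF has_derivative_inner[OF f2d f2d]]]
    by simp
  have Hmin: "\<forall>z\<in>ball x r. H y \<le> H z"
    using HF Hy y(2) by (metis ball_subset_cball order_trans subsetD)
  have zero: "inner (fst (D y h)) (sgn (fst (f y) - c1))
      + \<sigma> * (inner (y - x2) h + inner h (y - x2))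
      + j * (inner (snd (f y) - c2) (snd (D y h)) + inner (snd (D y h)) (snd (f y) - c2)) = 0" for h
    using fun_cong[OF differential_zero_maxmin[OF yint open_ball Hd disjI2[OF Hmin]], of h] .
  \<comment> \<open>The two distance terms of the stationarity condition assemble into the
    multiplier pair; only the localisation term is left over.\<close>
  have "inner (l1, l2) (D y h) = - (2 * \<sigma> * inner (y - x2) h)" for h
  proof -
    have "sgn (fst (f y) - c1) = l1" by (simp add: sgn_div_norm l1_def nrm1 inverse_eq_divide)
    then show ?thesis
      using zero[of h] by (simp add: l2_def inner_prod_def inner_commute algebra_simps)
  qed
  then have "\<bar>inner (l1, l2) (D y h)\<bar> \<le> 5 * (1 + L * K) * (d / r) * norm h" for h
  proof -
    assume eq: "\<And>h. inner (l1, l2) (D y h) = - (2 * \<sigma> * inner (y - x2) h)"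
    have "\<bar>inner (l1, l2) (D y h)\<bar> = 2 * \<sigma> * \<bar>inner (y - x2) h\<bar>"
      unfolding eq using \<sigma>pos by (simp add: abs_mult)
    also have "\<dots> \<le> 2 * \<sigma> * (norm (y - x2) * norm h)"
      using \<sigma>pos Cauchy_Schwarz_ineq2 by (intro mult_left_mono) auto
    also have "\<dots> \<le> 2 * \<sigma> * ((r / 2) * norm h)"
      using \<sigma>pos yx2 by (intro mult_left_mono mult_right_mono) (auto simp: dist_norm)
    also have "\<dots> = 5 * (1 + L * K) * (d / r) * norm h"
      using r by (simp add: \<sigma>_def d'_def power2_eq_square)
    finally show ?thesis .
  qed
  moreover have "norm l1 = 1" using nrm1 e1pos by (simp add: l1_def)
  moreover have "norm l2 \<le> 2 * K * (L + 10)" using nrm2 jpos je2 by (simp add: l2_def)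
  moreover have "l1 \<in> regular_normal_cone C1 c1"
    unfolding l1_def using e1pos c1 by (intro proximal_normal_regular) auto
  moreover have "l2 \<in> regular_normal_cone C2 c2"
    unfolding l2_def using jpos c2 by (intro proximal_normal_regular) auto
  moreover have "dist (fst (f y)) c1 \<le> (1 + L * K) * d" "dist (snd (f y)) c2 \<le> (1 + L * K) * d"
    using e1d e2d c1 c2 unfolding e1_def e2_def d'_def by simp_all
  ultimately show ?thesis using y(1) c1(1) c2(1) by (metis mem_cball)
qed

lemma LIMSEQ_of_less_inverse_Suc:
  fixes f :: "nat \<Rightarrow> 'a::real_normed_vector"
  assumes "\<And>k. norm (f k - l) < 1 / real (Suc k)"
  shows "f \<longlonglongrightarrow> l"
  using assms by (intro LIM_zero_cancel[OF Lim_null_comparison[OF _ LIMSEQ_Suc[OF lim_1_over_n]]])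
    (auto intro!: always_eventually less_imp_le)

section \<open>Limits of normals and image derivatives\<close>

text \<open>The cone definitions demand decreasing step lengths. Some subsequence is monotone, and a
  nondecreasing positive one cannot tend to 0.\<close>

lemma decreasing_subsequence:
  fixes s :: "nat \<Rightarrow> real"
  assumes "\<And>k. 0 < s k" "s \<longlonglongrightarrow> 0"
  obtains \<phi> where "strict_mono \<phi>" "decseq (s \<circ> \<phi>)"
proof -
  obtain \<phi> :: "nat \<Rightarrow> nat" where \<phi>: "strict_mono \<phi>" "monoseq (\<lambda>n. s (\<phi> n))"
    using seq_monosub by blast
  have lim: "(\<lambda>n. s (\<phi> n)) \<longlonglongrightarrow> 0"
    using LIMSEQ_subseq_LIMSEQ[OF assms(2) \<phi>(1)] by (simp add: o_def)
  have "\<not> incseq (\<lambda>n. s (\<phi> n))"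
    using incseq_le[OF _ lim] assms(1) not_le by blast
  then have "decseq (s \<circ> \<phi>)" using \<phi>(2) by (simp add: monoseq_iff o_def)
  then show ?thesis using that \<phi>(1) by blast
qed

text \<open>The approach is described by the points \<open>c k\<close> themselves, since projections
  are what the limit arguments produce. Passing to a subsequence makes the step lengths
  decreasing.\<close>

lemma dir_normal_coneI:
  assumes s: "\<And>k. 0 < s k" "s \<longlonglongrightarrow> (0::real)"
    and c: "\<And>k. c k \<in> \<Omega>" "\<And>k. l k \<in> regular_normal_cone \<Omega> (c k)"
    and lim: "(\<lambda>k. (1 / s k) *\<^sub>R (c k - z)) \<longlonglongrightarrow> w" "l \<longlonglongrightarrow> v"
  shows "v \<in> dir_normal_cone \<Omega> z w"
proof -
  obtain \<phi> where \<phi>: "strict_mono \<phi>" "decseq (s \<circ> \<phi>)"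
    using decreasing_subsequence[OF s] .
  have "z + s k *\<^sub>R ((1 / s k) *\<^sub>R (c k - z)) = c k" for k
    using s(1)[of k] by simp
  then show ?thesis
    unfolding dir_normal_cone_def
    using \<phi> s c LIMSEQ_subseq_LIMSEQ[OF s(2) \<phi>(1)]
      LIMSEQ_subseq_LIMSEQ[OF lim(1) \<phi>(1)] LIMSEQ_subseq_LIMSEQ[OF lim(2) \<phi>(1)]
    by (intro CollectI exI[of _ "s \<circ> \<phi>"] exI[of _ "(\<lambda>k. (1 / s k) *\<^sub>R (c k - z)) \<circ> \<phi>"]
        exI[of _ "l \<circ> \<phi>"]) auto
qed

lemma contingent_coneI:
  assumes s: "\<And>k. 0 < s k" "s \<longlonglongrightarrow> (0::real)"
    and c: "\<And>k. c k \<in> \<Omega>"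
    and lim: "(\<lambda>k. (1 / s k) *\<^sub>R (c k - z)) \<longlonglongrightarrow> w"
  shows "w \<in> contingent_cone \<Omega> z"
proof -
  obtain \<phi> where \<phi>: "strict_mono \<phi>" "decseq (s \<circ> \<phi>)"
    using decreasing_subsequence[OF s] .
  have "z + s k *\<^sub>R ((1 / s k) *\<^sub>R (c k - z)) = c k" for k
    using s(1)[of k] by simp
  then show ?thesis
    unfolding contingent_cone_def
    using \<phi> s c LIMSEQ_subseq_LIMSEQ[OF s(2) \<phi>(1)] LIMSEQ_subseq_LIMSEQ[OF lim(1) \<phi>(1)]
    by (intro CollectI exI[of _ "s \<circ> \<phi>"] exI[of _ "(\<lambda>k. (1 / s k) *\<^sub>R (c k - z)) \<circ> \<phi>"]) auto
qed

text \<open>A diagonal choice for an arbitrary filter: stage \<open>n\<close> imposes only finitely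
  many eventual conditions, so their conjunction is compatible with \<open>R n\<close>.\<close>

lemma frequently_eventually_sequence:
  assumes "\<And>n::nat. eventually (Q n) F" "\<And>n. frequently (R n) F"
  shows "\<exists>z. \<forall>n. R n (z n) \<and> (\<forall>m\<le>n. Q m (z n))"
proof -
  have "\<exists>z. R n z \<and> (\<forall>m\<le>n. Q m z)" for n
  proof -
    have "eventually (\<lambda>z. \<forall>m\<in>{..n}. Q m z) F"
      using assms(1) by (intro eventually_ball_finite) auto
    then show ?thesis
      using frequently_ex[OF frequently_eventually_conj[OF assms(2)[of n]]]
      by fastforce
  qed
  then show ?thesis by metis
qed

section \<open>Local control near the reference point and its sequential form\<close>

locale split_system =
  fixes g :: "'p::topological_space \<Rightarrow> 'x::euclidean_space \<Rightarrow> 'b::euclidean_space \<times> 'c::euclidean_space"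
    and Dg :: "'p \<Rightarrow> 'x \<Rightarrow> 'x \<Rightarrow>\<^sub>L ('b \<times> 'c)"
    and C1 :: "'b set" and C2 :: "'c set"
    and \<zeta> :: "'p \<Rightarrow> real" and pb :: 'p and xb :: 'x
  assumes closed1: "closed C1" and closed2: "closed C2"
    and gph: "g pb xb \<in> C1 \<times> C2"
    and standing: "standing_assumptions g Dg pb xb"
    and zeta_cont: "(\<zeta> \<longlongrightarrow> \<zeta> pb) (at pb)"
    and b: "robinson_stable (\<lambda>p x. snd (g p x)) C2 pb xb"
    and c: "\<And>v u lam1 lam2. v \<in> img_deriv g Dg \<zeta> pb xb \<Longrightarrow> (v, u) \<noteq> (0, 0) \<Longrightarrow>
        v + Dg pb xb u \<in> contingent_cone (C1 \<times> C2) (g pb xb) \<Longrightarrow>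
        lam1 \<in> dir_normal_cone C1 (fst (g pb xb)) (fst v + fst (Dg pb xb u)) \<Longrightarrow>
        lam2 \<in> dir_normal_cone C2 (snd (g pb xb)) (snd v + snd (Dg pb xb u)) \<Longrightarrow>
        adjoint (blinfun_apply (Dg pb xb)) (lam1, lam2) = 0 \<Longrightarrow> lam1 = 0"
begin

abbreviation "A \<equiv> Dg pb xb"

definition res :: "'p \<Rightarrow> 'x \<Rightarrow> real"
  where "res p x = infdist (g p x) (C1 \<times> C2)"

definition shift :: "'p \<Rightarrow> real"
  where "shift p = norm (g p xb - g pb xb)"

text \<open>The bounds on \<open>\<zeta>\<close>, \<open>shift\<close> and \<open>Dg\<close> serve
  the image derivative. The conditions on the ball are those that \<open>penalty_multipliers\<close>
  asks for; they provide an actual corrected point \<open>y\<close>, because an infimal distance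
  need not be attained.\<close>

definition good :: "real \<Rightarrow> real \<Rightarrow> real \<Rightarrow> 'p \<Rightarrow> bool"
  where "good K \<epsilon> \<delta> p \<longleftrightarrow> \<bar>\<zeta> p - \<zeta> pb\<bar> < \<epsilon> \<and> shift p < \<epsilon> \<and>
    (\<forall>x\<in>ball xb \<delta>. (g p has_derivative blinfun_apply (Dg p x)) (at x) \<and>
      norm (Dg p x - A) < \<epsilon> \<and>
      (\<exists>y. snd (g p y) \<in> C2 \<and> dist x y \<le> K * infdist (snd (g p x)) C2))"

text \<open>The space of parameters need not be first countable, so convergence \<open>p k \<longlonglongrightarrow> pb\<close> is not
  available for sequences of counterexamples; \<open>good_seq\<close> keeps only its countably many consequences
  that the argument uses.\<close>

definition good_seq :: "real \<Rightarrow> (nat \<Rightarrow> 'p) \<Rightarrow> bool"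
  where "good_seq K p \<longleftrightarrow> (\<forall>\<epsilon>>0. \<exists>\<delta>>0. \<forall>\<^sub>F k in sequentially. good K \<epsilon> \<delta> (p k))"

lemma good_seqD:
  assumes "good_seq K p" "0 < \<epsilon>"
  shows "\<exists>\<delta>>0. \<forall>\<^sub>F k in sequentially. good K \<epsilon> \<delta> (p k)"
  using assms by (simp add: good_seq_def)

lemma closed12: "closed (C1 \<times> C2)" and nonempty: "C1 \<noteq> {}" "C2 \<noteq> {}" "C1 \<times> C2 \<noteq> {}"
  using closed1 closed2 gph by (auto intro: closed_Times)

lemma res_nonneg: "0 \<le> res p x"
  by (simp add: res_def infdist_nonneg)

lemma res_eq_0: "res p x = 0 \<longleftrightarrow> g p x \<in> C1 \<times> C2"
  unfolding res_def using in_closed_iff_infdist_zero[OF closed12 nonempty(3)] by simp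

lemma shift_nonneg: "0 \<le> shift p"
  by (simp add: shift_def)

text \<open>\<open>K\<close> comes from (b) alone and is fixed before \<open>\<epsilon>\<close>, so
  that one constant serves a whole sequence of parameters.\<close>

lemma eventually_good:
  "\<exists>K\<ge>0. \<forall>\<epsilon>>0. \<exists>\<delta>>0. \<forall>\<^sub>F p in nhds pb. good K \<epsilon> \<delta> p"
proof -
  obtain \<kappa> U2 V2 where \<kappa>: "0 \<le> \<kappa>" "open U2" "xb \<in> U2" "open V2" "pb \<in> V2"
    and rob: "\<And>p x. p \<in> V2 \<Longrightarrow> x \<in> U2 \<Longrightarrow> {\<xi>. snd (g p \<xi>) \<in> C2} \<noteq> {}"
      "\<And>p x. p \<in> V2 \<Longrightarrow> x \<in> U2 \<Longrightarrow>
        infdist x {\<xi>. snd (g p \<xi>) \<in> C2} \<le> \<kappa> * infdist (snd (g p x)) C2"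
    using b nonempty unfolding robinson_stable_def by metis
  \<comment> \<open>With a positive residual, the slack between \<open>\<kappa>\<close> and
    \<open>\<kappa> + 1\<close> lets an actual point undercut the bound on the distance. With zero
    residual, \<open>x\<close> itself serves.\<close>
  have near: "\<exists>y. snd (g p y) \<in> C2 \<and> dist x y \<le> (\<kappa> + 1) * infdist (snd (g p x)) C2"
    if "p \<in> V2" "x \<in> U2" for p x
  proof (cases "snd (g p x) \<in> C2")
    case True
    then show ?thesis by (intro exI[of _ x]) simp
  next
    case False
    let ?S = "{\<xi>. snd (g p \<xi>) \<in> C2}" and ?e = "infdist (snd (g p x)) C2"
    have "0 < ?e" using infdist_pos_not_in_closed[OF closed2 nonempty(2) False] .
    note ne = rob(1)[OF that]
    from \<open>0 < ?e\<close> have "infdist x ?S < (\<kappa> + 1) * ?e" using rob(2)[OF that] by (simp add: algebra_simps)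
    then have "(INF a\<in>?S. dist x a) < (\<kappa> + 1) * ?e"
      using infdist_notempty[OF ne] by simp
    then obtain y where "y \<in> ?S" "dist x y < (\<kappa> + 1) * ?e"
      using cINF_less_iff[OF ne, of "dist x"] by (auto simp: bdd_below_def intro: zero_le_dist)
    then show ?thesis by (auto intro: less_imp_le)
  qed
  obtain U1 V1 where UV1: "open U1" "xb \<in> U1" "open V1" "pb \<in> V1"
    and der: "\<And>p x. p \<in> V1 \<Longrightarrow> x \<in> U1 \<Longrightarrow> (g p has_derivative blinfun_apply (Dg p x)) (at x)"
    using standing unfolding standing_assumptions_def by metis
  have gc: "((\<lambda>z. g (fst z) (snd z)) \<longlongrightarrow> g pb xb) (at (pb, xb))"
    and Dc: "((\<lambda>z. Dg (fst z) (snd z)) \<longlongrightarrow> Dg pb xb) (at (pb, xb))"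
    using standing unfolding standing_assumptions_def by auto
  have "\<exists>\<delta>>0. \<forall>\<^sub>F p in nhds pb. good (\<kappa> + 1) \<epsilon> \<delta> p" if "0 < \<epsilon>" for \<epsilon>
  proof -
    have "\<forall>\<^sub>F z in at (pb, xb). dist (g (fst z) (snd z)) (g pb xb) < \<epsilon> \<and> dist (Dg (fst z) (snd z)) A < \<epsilon>"
      using tendstoD[OF gc that] tendstoD[OF Dc that] by eventually_elim auto
    \<comment> \<open>The limits are over punctured neighbourhoods; at the point itself both
      distances are 0, so the bounds extend to the full filter. The same is done for
      \<open>\<zeta>\<close> below.\<close>
    then have "\<forall>\<^sub>F z in nhds (pb, xb). dist (g (fst z) (snd z)) (g pb xb) < \<epsilon> \<and> dist (Dg (fst z) (snd z)) A < \<epsilon>"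
      unfolding eventually_at_filter by eventually_elim (use that in auto)
    then obtain P Q where PQ: "eventually P (nhds pb)" "eventually Q (nhds xb)"
      "\<And>p x. P p \<Longrightarrow> Q x \<Longrightarrow> dist (g p x) (g pb xb) < \<epsilon> \<and> dist (Dg p x) A < \<epsilon>"
      unfolding nhds_prod eventually_prod_filter by auto
    have "\<forall>\<^sub>F x in nhds xb. Q x \<and> x \<in> U1 \<and> x \<in> U2"
      using PQ(2) eventually_nhds_in_open[OF UV1(1,2)] eventually_nhds_in_open[OF \<kappa>(2,3)]
      by eventually_elim auto
    then obtain \<delta> where \<delta>: "0 < \<delta>" "\<And>x. x \<in> ball xb \<delta> \<Longrightarrow> Q x \<and> x \<in> U1 \<and> x \<in> U2"
      unfolding eventually_nhds_metric by (auto simp: dist_commute)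
    have "\<forall>\<^sub>F p in at pb. \<bar>\<zeta> p - \<zeta> pb\<bar> < \<epsilon>"
      using tendstoD[OF zeta_cont that] by (simp add: dist_real_def)
    then have "\<forall>\<^sub>F p in nhds pb. \<bar>\<zeta> p - \<zeta> pb\<bar> < \<epsilon>"
      unfolding eventually_at_filter by eventually_elim (use that in auto)
    then have "\<forall>\<^sub>F p in nhds pb. good (\<kappa> + 1) \<epsilon> \<delta> p"
      using PQ(1) eventually_nhds_in_open[OF UV1(3,4)] eventually_nhds_in_open[OF \<kappa>(4,5)]
    proof eventually_elim
      case (elim p)
      have "shift p < \<epsilon>" using PQ(3)[of p xb] \<delta> elim by (simp add: shift_def dist_norm)
      then show ?case
        unfolding good_def using elim PQ(3) \<delta>(2) der near by (auto simp: dist_norm)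
    qed
    then show ?thesis using \<delta>(1) by blast
  qed
  then show ?thesis using \<kappa>(1) by (intro exI[of _ "\<kappa> + 1"]) auto
qed

lemma good_seq_subseq:
  assumes "good_seq K p" "strict_mono \<phi>"
  shows "good_seq K (\<lambda>k. p (\<phi> k))"
  using assms eventually_subseq[OF assms(2)] unfolding good_seq_def by blast

lemma good_seq_shift:
  assumes "good_seq K p"
  shows "(\<lambda>k. shift (p k)) \<longlonglongrightarrow> 0"
proof (rule tendstoI)
  fix \<epsilon> :: real assume "0 < \<epsilon>"
  then obtain \<delta> where "\<forall>\<^sub>F k in sequentially. good K \<epsilon> \<delta> (p k)"
    using assms unfolding good_seq_def by blast
  then show "\<forall>\<^sub>F k in sequentially. dist (shift (p k)) 0 < \<epsilon>"
    by eventually_elim (simp add: good_def shift_nonneg)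
qed

text \<open>This is the mean value inequality for \<open>g (p k) - A\<close>, whose derivative is
  smaller than \<open>\<epsilon>\<close> in norm on a ball common to almost all
  \<open>k\<close>.\<close>

lemma good_seq_linearization:
  assumes p: "good_seq K p" and y: "y \<longlonglongrightarrow> xb" and \<epsilon>: "0 < \<epsilon>"
  shows "\<forall>\<^sub>F k in sequentially.
    norm (g (p k) (y k) - g (p k) xb - A (y k - xb)) \<le> \<epsilon> * norm (y k - xb)"
proof -
  obtain \<delta> where \<delta>: "0 < \<delta>" "\<forall>\<^sub>F k in sequentially. good K \<epsilon> \<delta> (p k)"
    using good_seqD[OF p \<epsilon>] by blast
  have "\<forall>\<^sub>F k in sequentially. dist (y k) xb < \<delta>" using tendstoD[OF y \<delta>(1)] .
  with \<delta>(2) show ?thesis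
  proof eventually_elim
    case (elim k)
    let ?h = "\<lambda>x. g (p k) x - A x"
    have "norm (?h (y k) - ?h xb) \<le> \<epsilon> * norm (y k - xb)"
    proof (rule differentiable_bound)
      show "convex (ball xb \<delta>)" by simp
      show "y k \<in> ball xb \<delta>" "xb \<in> ball xb \<delta>" using elim \<delta> by (auto simp: dist_commute)
      fix x assume x: "x \<in> ball xb \<delta>"
      have "(g (p k) has_derivative blinfun_apply (Dg (p k) x)) (at x)"
        using elim x by (simp add: good_def)
      then have "(?h has_derivative blinfun_apply (Dg (p k) x - A)) (at x)"
        by (auto intro!: derivative_eq_intros simp: blinfun.diff_left)
      then show "(?h has_derivative blinfun_apply (Dg (p k) x - A)) (at x within ball xb \<delta>)"
        by (rule has_derivative_at_withinI)
      have "norm (Dg (p k) x - A) < \<epsilon>" using elim x by (simp add: good_def)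
      then show "onorm (blinfun_apply (Dg (p k) x - A)) \<le> \<epsilon>"
        by (simp add: norm_blinfun.rep_eq)
    qed
    then show ?case by (simp add: blinfun.diff_right algebra_simps)
  qed
qed

text \<open>Only directions matter, so any positive scale \<open>s\<close> is allowed: the
  normalised differences converge to \<open>sgn v\<close>, and conicity recovers \<open>v\<close>
  from it. The case \<open>v = 0\<close> is covered because 0 lies in the cone by
  definition.\<close>

lemma img_deriv_limit:
  assumes p: "good_seq K p" and s: "\<And>k. 0 < s k"
    and lim: "(\<lambda>k. (1 / s k) *\<^sub>R (g (p k) xb - g pb xb)) \<longlonglongrightarrow> v"
  shows "v \<in> img_deriv g Dg \<zeta> pb xb"
proof (cases "v = 0")
  case True
  then show ?thesis by (simp add: img_deriv_def)
next
  case False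
  define w where "w = (\<lambda>k. g (p k) xb - g pb xb)"
  have "(\<lambda>k. sgn ((1 / s k) *\<^sub>R w k)) \<longlonglongrightarrow> sgn v"
    using lim False unfolding w_def by (intro tendsto_sgn)
  then have sgn: "(\<lambda>k. sgn (w k)) \<longlonglongrightarrow> sgn v"
    using s by (simp add: sgn_scaleR)
  have "\<forall>\<^sub>F k in sequentially. (1 / s k) *\<^sub>R w k \<noteq> 0"
    using tendsto_imp_eventually_ne[OF lim False] by (simp add: w_def)
  then have nz: "\<forall>\<^sub>F k in sequentially. w k \<noteq> 0" by eventually_elim auto
  \<comment> \<open>The bounds \<open>1 / Suc j\<close> must hold at every index, so a late enough
    term is selected for each \<open>j\<close>; the condition \<open>n \<ge> j\<close> preserves the
    limit.\<close>
  have "\<exists>n\<ge>j. w n \<noteq> 0 \<and> norm (w n) < 1 / real (Suc j) \<and>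
      norm (Dg (p n) xb - A) < 1 / real (Suc j) \<and> \<bar>\<zeta> (p n) - \<zeta> pb\<bar> < 1 / real (Suc j)" for j
  proof -
    obtain \<delta> where \<delta>: "0 < \<delta>" "\<forall>\<^sub>F k in sequentially. good K (1 / real (Suc j)) \<delta> (p k)"
      using good_seqD[OF p, of "1 / real (Suc j)"] by auto
    have "\<forall>\<^sub>F n in sequentially. n \<ge> j \<and> w n \<noteq> 0 \<and> good K (1 / real (Suc j)) \<delta> (p n)"
      using \<delta>(2) nz eventually_ge_at_top[of j] by eventually_elim auto
    from eventually_happens'[OF sequentially_bot this]
    obtain n where "n \<ge> j" "w n \<noteq> 0" "good K (1 / real (Suc j)) \<delta> (p n)"
      by blast
    then show ?thesis using \<delta>(1) by (intro exI[of _ n]) (simp add: good_def shift_def w_def)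
  qed
  then obtain n where n: "\<And>j. n j \<ge> j" "\<And>j. w (n j) \<noteq> 0"
    "\<And>j. norm (w (n j)) < 1 / real (Suc j)" "\<And>j. norm (Dg (p (n j)) xb - A) < 1 / real (Suc j)"
    "\<And>j. \<bar>\<zeta> (p (n j)) - \<zeta> pb\<bar> < 1 / real (Suc j)"
    by metis
  have "filterlim n at_top sequentially"
    using n(1) by (intro filterlim_at_top_mono[OF filterlim_ident]) auto
  then have "(\<lambda>j. sgn (w (n j))) \<longlonglongrightarrow> sgn v"
    using filterlim_compose[OF sgn] by blast
  moreover have "(1 / norm (g (p (n j)) xb - g pb xb)) *\<^sub>R (g (p (n j)) xb - g pb xb) = sgn (w (n j))" for j
    by (simp add: w_def sgn_div_norm inverse_eq_divide)
  ultimately have "(\<lambda>j. (1 / norm (g (p (n j)) xb - g pb xb)) *\<^sub>R (g (p (n j)) xb - g pb xb)) \<longlonglongrightarrow> sgn v"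
    by presburger
  moreover have "0 < norm (g (p (n j)) xb - g pb xb)" for j
    using n(2)[of j] by (simp add: w_def)
  ultimately have "sgn v \<in> img_dir_set g Dg \<zeta> pb xb"
    unfolding img_dir_set_def using n(3-5)[unfolded w_def]
    by (intro CollectI exI[of _ "\<lambda>j. p (n j)"] conjI allI)
  then have "norm v *\<^sub>R sgn v \<in> Z" if "cone Z" "img_dir_set g Dg \<zeta> pb xb \<subseteq> Z" for Z
    using that unfolding cone_def by auto
  moreover have "norm v *\<^sub>R sgn v = v" using False by (simp add: sgn_div_norm)
  ultimately show ?thesis unfolding img_deriv_def by auto
qed

lemma good_seq_derivative:
  assumes p: "good_seq K p" and y: "y \<longlonglongrightarrow> xb"
  shows "(\<lambda>k. Dg (p k) (y k)) \<longlonglongrightarrow> A"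
proof (rule tendstoI)
  fix \<epsilon> :: real assume "0 < \<epsilon>"
  then obtain \<delta> where \<delta>: "0 < \<delta>" "\<forall>\<^sub>F k in sequentially. good K \<epsilon> \<delta> (p k)"
    using good_seqD[OF p] by blast
  have "\<forall>\<^sub>F k in sequentially. dist (y k) xb < \<delta>" using tendstoD[OF y \<delta>(1)] .
  with \<delta>(2) show "\<forall>\<^sub>F k in sequentially. dist (Dg (p k) (y k)) A < \<epsilon>"
    by eventually_elim (simp add: good_def dist_norm norm_minus_commute)
qed

text \<open>The linearisation error is negligible relative to \<open>y k - xb\<close>, which is
  itself of order \<open>T k\<close>.\<close>

lemma good_seq_remainder:
  assumes p: "good_seq K p" and y: "y \<longlonglongrightarrow> xb" and T: "\<And>k. 0 < T k"
    and u: "(\<lambda>k. (1 / T k) *\<^sub>R (y k - xb)) \<longlonglongrightarrow> u"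
  shows "(\<lambda>k. (1 / T k) *\<^sub>R (g (p k) (y k) - g (p k) xb - A (y k - xb))) \<longlonglongrightarrow> 0"
proof (rule tendstoI)
  fix \<epsilon> :: real assume \<epsilon>: "0 < \<epsilon>"
  define B where "B = norm u + 1"
  have B: "0 < B" unfolding B_def using norm_ge_zero[of u] by linarith
  have "\<forall>\<^sub>F k in sequentially. norm ((1 / T k) *\<^sub>R (y k - xb)) < B"
    using order_tendstoD(2)[OF tendsto_norm[OF u], of B] by (simp add: B_def)
  moreover have "\<forall>\<^sub>F k in sequentially.
      norm (g (p k) (y k) - g (p k) xb - A (y k - xb)) \<le> \<epsilon> / B * norm (y k - xb)"
    using \<epsilon> B by (intro good_seq_linearization[OF p y]) simp
  ultimately show "\<forall>\<^sub>F k in sequentially.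
      dist ((1 / T k) *\<^sub>R (g (p k) (y k) - g (p k) xb - A (y k - xb))) 0 < \<epsilon>"
  proof eventually_elim
    case (elim k)
    have n: "norm (y k - xb) < B * T k" using elim(1)[unfolded norm_scaleR] T[of k] by (simp add: field_simps)
    have "\<epsilon> / B * norm (y k - xb) < \<epsilon> / B * (B * T k)"
      using n \<epsilon> B by (intro mult_strict_left_mono) auto
    then have "norm (g (p k) (y k) - g (p k) xb - A (y k - xb)) < \<epsilon> * T k"
      using elim(2) B by simp
    then show ?case
      unfolding dist_norm diff_zero norm_scaleR using T[of k] by (simp add: field_simps)
  qed
qed

text \<open>The radius \<open>r\<close> lies between the residual and \<open>t\<close> in order of
  magnitude. Since \<open>res / r\<close> vanishes, the stationarity defect from
  \<open>penalty_multipliers\<close> on \<open>cball (x k) (r k)\<close> disappears in the limit;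
  since \<open>r / t\<close> vanishes, the minimisers have the same limit direction as
  \<open>x k\<close> at scale \<open>t\<close>. The first multipliers have norm one, and so has
  their limit, which (c) forbids.\<close>

lemma no_critical_sequence:
  assumes K: "0 \<le> K" and p: "good_seq K p" and x: "x \<longlonglongrightarrow> xb"
    and t: "\<And>k. t k = shift (p k) + norm (x k - xb)"
    and r: "\<And>k. 0 < r k" "(\<lambda>k. r k / t k) \<longlonglongrightarrow> 0" "(\<lambda>k. res (p k) (x k) / r k) \<longlonglongrightarrow> 0"
    and infeas: "\<And>k \<xi>. \<xi> \<in> cball (x k) (r k) \<Longrightarrow> g (p k) \<xi> \<notin> C1 \<times> C2"
  shows False
proof -
  define d where "d = (\<lambda>k. res (p k) (x k))"
  define L where "L = norm A + 1"
  define M where "M = 1 + L * K"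
  have L: "0 \<le> L" by (simp add: L_def)
  have M: "1 \<le> M" using L K by (simp add: M_def)
  \<comment> \<open>If \<open>t k = 0\<close>, then \<open>x k = xb\<close> and
    \<open>g (p k) xb = g pb xb\<close>, so the centre of the ball would be feasible.\<close>
  have t_pos: "0 < t k" for k
  proof (rule ccontr)
    assume "\<not> 0 < t k"
    then have "shift (p k) = 0" "norm (x k - xb) = 0"
      using t[of k] shift_nonneg[of "p k"] norm_ge_zero[of "x k - xb"] by linarith+
    then have "g (p k) (x k) \<in> C1 \<times> C2" using gph by (simp add: shift_def)
    then show False using infeas[of "x k" k] r(1)[of k] by simp
  qed
  have d0: "0 \<le> d k" for k by (simp add: d_def res_nonneg)
  have x0: "(\<lambda>k. norm (x k - xb)) \<longlonglongrightarrow> 0"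
    using x by (simp add: LIM_zero tendsto_norm_zero)
  have t0: "t \<longlonglongrightarrow> 0"
  proof -
    have "t = (\<lambda>k. shift (p k) + norm (x k - xb))" using t by auto
    then show ?thesis using tendsto_add[OF good_seq_shift[OF p] x0] by simp
  qed
  have r0: "r \<longlonglongrightarrow> 0"
    using tendsto_mult[OF r(2) t0] t_pos by (simp add: less_imp_neq[THEN not_sym])
  have dt: "(\<lambda>k. d k / t k) \<longlonglongrightarrow> 0"
  proof -
    have "res (p k) (x k) / r k * (r k / t k) = d k / t k" for k
      using r(1)[of k] by (simp add: d_def)
    then show ?thesis using tendsto_mult[OF r(3) r(2)] by (simp only: mult_zero_left)
  qed
  define \<Phi> where "\<Phi> = (\<lambda>k y c1 c2 l1 l2. dist (x k) y \<le> r k \<and> c1 \<in> C1 \<and> c2 \<in> C2 \<and>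
      dist (fst (g (p k) y)) c1 \<le> M * d k \<and> dist (snd (g (p k) y)) c2 \<le> M * d k \<and>
      l1 \<in> regular_normal_cone C1 c1 \<and> l2 \<in> regular_normal_cone C2 c2 \<and>
      norm l1 = 1 \<and> norm l2 \<le> 2 * K * (L + 10) \<and>
      (\<forall>h. \<bar>inner (l1, l2) (Dg (p k) y h)\<bar> \<le> 5 * M * (d k / r k) * norm h))"
  have in_ball: "\<forall>\<^sub>F k in sequentially. cball (x k) (r k) \<subseteq> ball xb \<delta>" if "0 < \<delta>" for \<delta>
  proof -
    have "(\<lambda>k. norm (x k - xb) + r k) \<longlonglongrightarrow> 0 + 0" by (intro tendsto_add x0 r0)
    then have "\<forall>\<^sub>F k in sequentially. norm (x k - xb) + r k < \<delta>"
      using order_tendstoD(2) that by fastforce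
    then show ?thesis
    proof eventually_elim
      case (elim k)
      show ?case
      proof
        fix y assume "y \<in> cball (x k) (r k)"
        then show "y \<in> ball xb \<delta>"
          using elim dist_triangle[of xb y "x k"] by (simp add: dist_norm norm_minus_commute)
      qed
    qed
  qed
  have "\<forall>\<^sub>F k in sequentially. \<exists>y c1 c2 l1 l2. \<Phi> k y c1 c2 l1 l2"
  proof -
    obtain \<delta> where \<delta>: "0 < \<delta>" "\<forall>\<^sub>F k in sequentially. good K 1 \<delta> (p k)"
      using good_seqD[OF p zero_less_one] by blast
    \<comment> \<open>Below \<open>e\<close>, the ratio \<open>d k / r k\<close> meets both size
      conditions of \<open>penalty_multipliers\<close>; the added 1 keeps the denominator positive
      when \<open>K = 0\<close>.\<close>
    define e where "e = min (1 / (4 * K + 1)) (1 / M)"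
    have "0 < e" using K M by (simp add: e_def)
    have "\<forall>\<^sub>F k in sequentially. d k / r k < e"
      using order_tendstoD(2)[OF r(3) \<open>0 < e\<close>] by (simp add: d_def)
    with \<delta>(2) in_ball[OF \<delta>(1)] show ?thesis
    proof eventually_elim
      case (elim k)
      have "d k / r k < 1 / (4 * K + 1)" "d k / r k < 1 / M" using elim(3) by (simp_all add: e_def)
      then have "(4 * K + 1) * d k \<le> r k" "M * d k \<le> r k"
        using r(1)[of k] K M by (simp_all add: field_simps)
      then have small: "4 * K * d k \<le> r k" "(1 + L * K) * d k \<le> r k"
        using d0[of k] by (simp_all add: algebra_simps M_def)
      have der: "(g (p k) has_derivative blinfun_apply (Dg (p k) y)) (at y)"
        and near: "\<exists>y'. snd (g (p k) y') \<in> C2 \<and> dist y y' \<le> K * infdist (snd (g (p k) y)) C2"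
        and "norm (Dg (p k) y - A) < 1"
        if "y \<in> cball (x k) (r k)" for y
        using elim that by (auto simp: good_def)
      then have bound: "norm (Dg (p k) y) \<le> L" if "y \<in> cball (x k) (r k)" for y
        using that norm_triangle_ineq2[of "Dg (p k) y" A] by (fastforce simp: L_def)
      have dk: "d k = infdist (g (p k) (x k)) (C1 \<times> C2)" by (simp add: d_def res_def)
      show ?case
        unfolding \<Phi>_def M_def
        by (rule penalty_multipliers[where f = "g (p k)" and D = "Dg (p k)"])
          (fact closed1 nonempty closed2 r(1) der L bound K near infeas dk small)+
    qed
  qed
  then obtain N where N: "\<And>k. k \<ge> N \<Longrightarrow> \<exists>y c1 c2 l1 l2. \<Phi> k y c1 c2 l1 l2"
    unfolding eventually_sequentially by blast
  then have "\<forall>k. \<exists>y c1 c2 l1 l2. \<Phi> (k + N) y c1 c2 l1 l2" by simp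
  then obtain y c1 c2 l1 l2 where yl: "\<And>k. \<Phi> (k + N) (y k) (c1 k) (c2 k) (l1 k) (l2 k)"
    by metis
  \<comment> \<open>Bundling the scaled displacement, the scaled parameter shift and both
    multipliers yields one convergent subsequence for all four.\<close>
  define q where "q = (\<lambda>k. (((1 / t (k + N)) *\<^sub>R (x (k + N) - xb),
      (1 / t (k + N)) *\<^sub>R (g (p (k + N)) xb - g pb xb)), (l1 k, l2 k)))"
  have "bounded (range q)"
  proof -
    have "q k \<in> (cball 0 1 \<times> cball 0 1) \<times> (cball 0 1 \<times> cball 0 (2 * K * (L + 10)))" for k
    proof -
      have "norm (x (k + N) - xb) \<le> t (k + N)" "norm (g (p (k + N)) xb - g pb xb) \<le> t (k + N)"
        using t[of "k + N"] by (simp_all add: shift_def)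
      then show ?thesis
        using yl[of k] t_pos[of "k + N"] by (simp add: q_def \<Phi>_def)
    qed
    then show ?thesis
      by (intro bounded_subset[OF bounded_Times[OF bounded_Times[OF bounded_cball bounded_cball]
              bounded_Times[OF bounded_cball bounded_cball]]]) blast
  qed
  then obtain qq \<phi> where \<phi>: "strict_mono \<phi>" "(q \<circ> \<phi>) \<longlonglongrightarrow> qq"
    using bounded_imp_convergent_subsequence by blast
  obtain u v m1 m2 where qq: "qq = ((u, v), (m1, m2))" by (metis surj_pair)
  define \<psi> where "\<psi> = (\<lambda>k. \<phi> k + N)"
  have \<psi>: "strict_mono \<psi>" using \<phi>(1) by (simp add: \<psi>_def strict_mono_def)
  have sub: "(\<lambda>k. f (\<psi> k)) \<longlonglongrightarrow> l" if "f \<longlonglongrightarrow> l" for f :: "nat \<Rightarrow> 'q::topological_space" and l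
    using LIMSEQ_subseq_LIMSEQ[OF that \<psi>] by (simp add: o_def)
  have u: "(\<lambda>k. (1 / t (\<psi> k)) *\<^sub>R (x (\<psi> k) - xb)) \<longlonglongrightarrow> u"
    using tendsto_fst[OF tendsto_fst[OF \<phi>(2)]] by (simp add: qq q_def \<psi>_def o_def)
  have v: "(\<lambda>k. (1 / t (\<psi> k)) *\<^sub>R (g (p (\<psi> k)) xb - g pb xb)) \<longlonglongrightarrow> v"
    using tendsto_snd[OF tendsto_fst[OF \<phi>(2)]] by (simp add: qq q_def \<psi>_def o_def)
  have m1: "(\<lambda>k. l1 (\<phi> k)) \<longlonglongrightarrow> m1"
    using tendsto_fst[OF tendsto_snd[OF \<phi>(2)]] by (simp add: qq q_def o_def)
  have m2: "(\<lambda>k. l2 (\<phi> k)) \<longlonglongrightarrow> m2"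
    using tendsto_snd[OF tendsto_snd[OF \<phi>(2)]] by (simp add: qq q_def o_def)
  define P where "P = (\<lambda>k. p (\<psi> k))"
  define T where "T = (\<lambda>k. t (\<psi> k))"
  define Y where "Y = (\<lambda>k. y (\<phi> k))"
  have P: "good_seq K P" unfolding P_def by (rule good_seq_subseq[OF p \<psi>])
  have T: "\<And>k. 0 < T k" "T \<longlonglongrightarrow> 0" using t_pos sub[OF t0] by (simp_all add: T_def)
  have yl': "\<Phi> (\<psi> k) (Y k) (c1 (\<phi> k)) (c2 (\<phi> k)) (l1 (\<phi> k)) (l2 (\<phi> k))" for k
    using yl[of "\<phi> k"] by (simp add: \<psi>_def Y_def)
  have yx: "norm (Y k - x (\<psi> k)) \<le> r (\<psi> k)" for k
    using yl'[of k] by (simp add: \<Phi>_def dist_norm norm_minus_commute)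
  have "(\<lambda>k. Y k - x (\<psi> k)) \<longlonglongrightarrow> 0"
    using yx by (intro Lim_null_comparison[OF _ sub[OF r0]]) auto
  from tendsto_add[OF this sub[OF x]] have Y: "Y \<longlonglongrightarrow> xb" by simp
  have "(\<lambda>k. (1 / T k) *\<^sub>R (Y k - x (\<psi> k))) \<longlonglongrightarrow> 0"
    using yx T(1) by (intro Lim_null_comparison[OF _ sub[OF r(2)]])
      (auto simp: T_def divide_right_mono less_imp_le)
  from tendsto_add[OF this u] have uY: "(\<lambda>k. (1 / T k) *\<^sub>R (Y k - xb)) \<longlonglongrightarrow> u"
    by (simp add: T_def flip: scaleR_add_right)
  have vP: "(\<lambda>k. (1 / T k) *\<^sub>R (g (P k) xb - g pb xb)) \<longlonglongrightarrow> v"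
    using v by (simp add: T_def P_def)
  have vD: "v \<in> img_deriv g Dg \<zeta> pb xb"
    by (rule img_deriv_limit[OF P T(1) vP])
  have nz: "(v, u) \<noteq> (0, 0)"
  proof -
    \<comment> \<open>By the choice of \<open>t\<close> the two scaled norms add up to exactly one,
      so the limit direction cannot vanish.\<close>
    have "norm ((1 / T k) *\<^sub>R (g (P k) xb - g pb xb)) + norm ((1 / T k) *\<^sub>R (x (\<psi> k) - xb)) = 1" for k
    proof -
      have "norm (g (P k) xb - g pb xb) + norm (x (\<psi> k) - xb) = T k"
        using t[of "\<psi> k"] by (simp add: T_def P_def shift_def)
      then show ?thesis using T(1)[of k] by (simp add: add_divide_distrib[symmetric])
    qed
    then have "(\<lambda>k. 1) \<longlonglongrightarrow> norm v + norm u"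
      using tendsto_add[OF tendsto_norm[OF vP] tendsto_norm[OF u[folded T_def]]]
      by (simp add: T_def)
    then have "norm v + norm u = 1" using LIMSEQ_unique[OF tendsto_const] by metis
    then show ?thesis by auto
  qed
  define c where "c = (\<lambda>k. (c1 (\<phi> k), c2 (\<phi> k)))"
  have lin: "(\<lambda>k. (1 / T k) *\<^sub>R (g (P k) (Y k) - g (P k) xb - A (Y k - xb))) \<longlonglongrightarrow> 0"
    by (rule good_seq_remainder[OF P Y T(1) uY])
  \<comment> \<open>The projections onto \<open>C1\<close> and \<open>C2\<close> miss
    \<open>g (P k) (Y k)\<close> by a multiple of \<open>d\<close>, which is negligible at scale
    \<open>t\<close>. They therefore inherit its limit direction.\<close>
  have proj: "(\<lambda>k. (1 / T k) *\<^sub>R (c k - g (P k) (Y k))) \<longlonglongrightarrow> 0"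
  proof (rule Lim_null_comparison)
    show "(\<lambda>k. 2 * M * (d (\<psi> k) / t (\<psi> k))) \<longlonglongrightarrow> 0"
      using tendsto_mult_right_zero[OF sub[OF dt]] .
    have "norm ((1 / T k) *\<^sub>R (c k - g (P k) (Y k))) \<le> 2 * M * (d (\<psi> k) / t (\<psi> k))" for k
    proof -
      have "norm (c k - g (P k) (Y k)) \<le> dist (fst (g (P k) (Y k))) (c1 (\<phi> k)) + dist (snd (g (P k) (Y k))) (c2 (\<phi> k))"
        using norm_Pair_le[of "c1 (\<phi> k) - fst (g (P k) (Y k))" "c2 (\<phi> k) - snd (g (P k) (Y k))"]
        by (simp add: c_def dist_norm norm_minus_commute minus_prod_def)
      also have "\<dots> \<le> 2 * M * d (\<psi> k)"
        using yl'[of k] by (simp add: \<Phi>_def P_def)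
      finally show ?thesis using T(1)[of k] by (simp add: T_def divide_right_mono)
    qed
    then show "\<forall>\<^sub>F k in sequentially. norm ((1 / T k) *\<^sub>R (c k - g (P k) (Y k))) \<le> 2 * M * (d (\<psi> k) / t (\<psi> k))"
      by simp
  qed
  have Au: "(\<lambda>k. A ((1 / T k) *\<^sub>R (Y k - xb))) \<longlonglongrightarrow> A u"
    by (intro tendsto_intros uY)
  have dir: "(\<lambda>k. (1 / T k) *\<^sub>R (c k - g pb xb)) \<longlonglongrightarrow> v + A u"
  proof -
    \<comment> \<open>The four summands are projection error, linearisation error, parameter shift
      and linear term; the first two vanish in the limit.\<close>
    have "(1 / T k) *\<^sub>R (c k - g pb xb) = (1 / T k) *\<^sub>R (c k - g (P k) (Y k))
        + (1 / T k) *\<^sub>R (g (P k) (Y k) - g (P k) xb - A (Y k - xb))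
        + ((1 / T k) *\<^sub>R (g (P k) xb - g pb xb) + A ((1 / T k) *\<^sub>R (Y k - xb)))" for k
      by (simp add: blinfun.scaleR_right flip: scaleR_add_right)
    then show ?thesis
      using tendsto_add[OF tendsto_add[OF proj lin] tendsto_add[OF vP Au]] by simp
  qed
  have cC: "c k \<in> C1 \<times> C2" for k using yl'[of k] by (simp add: \<Phi>_def c_def)
  have "v + A u \<in> contingent_cone (C1 \<times> C2) (g pb xb)"
    by (rule contingent_coneI[OF T cC dir])
  moreover have "m1 \<in> dir_normal_cone C1 (fst (g pb xb)) (fst v + fst (A u))"
    using tendsto_fst[OF dir] yl' m1
    by (intro dir_normal_coneI[OF T, of "\<lambda>k. c1 (\<phi> k)" _ "\<lambda>k. l1 (\<phi> k)"]) (simp_all add: \<Phi>_def c_def)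
  moreover have "m2 \<in> dir_normal_cone C2 (snd (g pb xb)) (snd v + snd (A u))"
    using tendsto_snd[OF dir] yl' m2
    by (intro dir_normal_coneI[OF T, of "\<lambda>k. c2 (\<phi> k)" _ "\<lambda>k. l2 (\<phi> k)"]) (simp_all add: \<Phi>_def c_def)
  moreover have "adjoint (blinfun_apply A) (m1, m2) = 0"
  proof -
    have "inner (m1, m2) (A h) = 0" for h
    proof -
      have D: "(\<lambda>k. Dg (P k) (Y k)) \<longlonglongrightarrow> A"
        by (rule good_seq_derivative[OF P Y])
      have "(\<lambda>k. inner (l1 (\<phi> k), l2 (\<phi> k)) (Dg (P k) (Y k) h)) \<longlonglongrightarrow> inner (m1, m2) (A h)"
        by (intro tendsto_intros m1 m2 D)
      moreover have "(\<lambda>k. inner (l1 (\<phi> k), l2 (\<phi> k)) (Dg (P k) (Y k) h)) \<longlonglongrightarrow> 0"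
      proof (rule Lim_null_comparison)
        have "(\<lambda>k. 5 * M * (d (\<psi> k) / r (\<psi> k)) * norm h) \<longlonglongrightarrow> 5 * M * 0 * norm h"
          using sub[OF r(3)] by (intro tendsto_intros) (simp add: d_def)
        then show "(\<lambda>k. 5 * M * (d (\<psi> k) / r (\<psi> k)) * norm h) \<longlonglongrightarrow> 0" by simp
        show "\<forall>\<^sub>F k in sequentially. norm (inner (l1 (\<phi> k), l2 (\<phi> k)) (Dg (P k) (Y k) h))
            \<le> 5 * M * (d (\<psi> k) / r (\<psi> k)) * norm h"
          using yl' by (simp add: \<Phi>_def P_def)
      qed
      ultimately show ?thesis by (rule LIMSEQ_unique)
    qed
    then have "inner (adjoint (blinfun_apply A) (m1, m2)) h = 0" for h
      using adjoint_works[OF bounded_linear.linear[OF blinfun.bounded_linear_right[of A]], of h "(m1, m2)"]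
      by (simp add: inner_commute)
    then show ?thesis by (metis inner_eq_zero_iff)
  qed
  ultimately have "m1 = 0" using c[OF vD nz] by blast
  moreover have "norm m1 = 1"
  proof (rule LIMSEQ_unique[OF tendsto_norm[OF m1]])
    show "(\<lambda>k. norm (l1 (\<phi> k))) \<longlonglongrightarrow> 1" using yl' by (simp add: \<Phi>_def)
  qed
  ultimately show False by simp
qed

text \<open>Counterexamples to ever weaker estimates become one sequence of controlled parameters.
  \<open>Q\<close> survives any reindexing \<open>\<psi>\<close> and any replacement of
  \<open>x\<close> by \<open>y\<close> tending to \<open>xb\<close>, because its condition
  \<open>V\<close> on the parameter is built into every stage of the choice.\<close>

lemma frequently_good_sequence:
  assumes "\<And>n. \<exists>\<^sub>F z in nhds pb \<times>\<^sub>F nhds xb. R n z"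
    and "\<forall>\<^sub>F z in nhds pb \<times>\<^sub>F nhds xb. Q z"
  shows "\<exists>K p x. 0 \<le> K \<and> good_seq K p \<and> x \<longlonglongrightarrow> xb \<and> (\<forall>n. R n (p n, x n)) \<and>
    (\<forall>\<psi> y. y \<longlonglongrightarrow> xb \<longrightarrow> (\<forall>\<^sub>F n in sequentially. Q (p (\<psi> n :: nat), y n)))"
proof -
  obtain K where K: "0 \<le> K" "\<And>\<epsilon>. 0 < \<epsilon> \<Longrightarrow> \<exists>\<delta>>0. \<forall>\<^sub>F p in nhds pb. good K \<epsilon> \<delta> p"
    using eventually_good by blast
  have "\<exists>\<delta>>0. \<forall>\<^sub>F p in nhds pb. good K (1 / real (Suc m)) \<delta> p" for m
    by (rule K(2)) simp
  then obtain \<delta> where \<delta>: "\<And>m. 0 < \<delta> m" "\<And>m. \<forall>\<^sub>F p in nhds pb. good K (1 / real (Suc m)) (\<delta> m) p"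
    by metis
  obtain V W where VW: "eventually V (nhds pb)" "eventually W (nhds xb)"
    "\<And>p x. V p \<Longrightarrow> W x \<Longrightarrow> Q (p, x)"
    using assms(2) unfolding eventually_prod_filter by auto
  define G where "G = (\<lambda>m z. (good K (1 / real (Suc m)) (\<delta> m) (fst z) \<and> V (fst z)) \<and>
      norm (snd z - xb) < 1 / real (Suc m))"
  have "eventually (G m) (nhds pb \<times>\<^sub>F nhds xb)" for m
    unfolding G_def
  proof (rule eventually_prodI)
    show "\<forall>\<^sub>F p in nhds pb. good K (1 / real (Suc m)) (\<delta> m) p \<and> V p"
      using \<delta>(2) VW(1) by (rule eventually_conj)
    have "\<forall>\<^sub>F x in nhds xb. dist x xb < 1 / real (Suc m)"
      unfolding eventually_nhds_metric by (intro exI[of _ "1 / real (Suc m)"]) auto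
    then show "\<forall>\<^sub>F x in nhds xb. norm (x - xb) < 1 / real (Suc m)"
      by (simp add: dist_norm)
  qed
  from frequently_eventually_sequence[of G, OF this assms(1)]
  obtain z where zRG: "\<forall>n. R n (z n) \<and> (\<forall>m\<le>n. G m (z n))" ..
  then have z: "\<And>n. R n (z n)"
    "\<And>n m. m \<le> n \<Longrightarrow> good K (1 / real (Suc m)) (\<delta> m) (fst (z n)) \<and> V (fst (z n)) \<and>
        norm (snd (z n) - xb) < 1 / real (Suc m)"
    by (simp_all add: G_def)
  have "good_seq K (\<lambda>n. fst (z n))"
    unfolding good_seq_def
  proof (intro allI impI)
    fix \<epsilon> :: real assume "0 < \<epsilon>"
    then obtain m where m: "1 / real (Suc m) < \<epsilon>" using nat_approx_posE by blast
    have "\<forall>\<^sub>F n in sequentially. good K \<epsilon> (\<delta> m) (fst (z n))"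
      using eventually_ge_at_top[of m]
    proof eventually_elim
      case (elim n)
      then have "good K (1 / real (Suc m)) (\<delta> m) (fst (z n))" using z(2) by blast
      then show ?case using m unfolding good_def by (meson less_trans)
    qed
    then show "\<exists>\<delta>>0. \<forall>\<^sub>F n in sequentially. good K \<epsilon> \<delta> (fst (z n))"
      using \<delta>(1) by blast
  qed
  moreover have "(\<lambda>n. snd (z n)) \<longlonglongrightarrow> xb"
    using z(2) by (intro LIMSEQ_of_less_inverse_Suc) blast
  moreover have "\<forall>\<^sub>F n in sequentially. Q (fst (z (\<psi> n)), y n)" if "y \<longlonglongrightarrow> xb" for \<psi> y
  proof -
    have "\<forall>\<^sub>F n in sequentially. W (y n)" using that VW(2) by (rule eventually_compose_filterlim[rotated])
    then show ?thesis by eventually_elim (use z(2) VW(3) in blast)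
  qed
  moreover have "R n (fst (z n), snd (z n))" for n using z(1) by simp
  ultimately show ?thesis using K(1) by blast
qed

section \<open>The distance estimate\<close>

text \<open>If every \<open>c = 1 / Suc n\<close> failed, there would be points with ever smaller
  ratio of residual to \<open>shift p + norm (x - xb)\<close> and no feasible point within
  \<open>Suc n\<close> times the residual. That leaves room for a radius as in
  \<open>no_critical_sequence\<close>.\<close>

lemma local_estimate:
  "\<exists>c>0. \<forall>\<^sub>F (p, x) in nhds pb \<times>\<^sub>F nhds xb.
     res p x < c * (shift p + norm (x - xb)) \<longrightarrow>
     (\<exists>\<xi>. g p \<xi> \<in> C1 \<times> C2 \<and> dist x \<xi> \<le> res p x / c)"
proof (rule ccontr)
  assume contra: "\<not> ?thesis"
  define R where "R = (\<lambda>n (p, x). res p x < 1 / real (Suc n) * (shift p + norm (x - xb)) \<and>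
      (\<forall>\<xi>. g p \<xi> \<in> C1 \<times> C2 \<longrightarrow> real (Suc n) * res p x < dist x \<xi>))"
  have "\<exists>\<^sub>F z in nhds pb \<times>\<^sub>F nhds xb. R n z" for n
  proof -
    have "0 < 1 / real (Suc n)" by simp
    then have "\<not> (\<forall>\<^sub>F (p, x) in nhds pb \<times>\<^sub>F nhds xb.
        res p x < 1 / real (Suc n) * (shift p + norm (x - xb)) \<longrightarrow>
        (\<exists>\<xi>. g p \<xi> \<in> C1 \<times> C2 \<and> dist x \<xi> \<le> res p x / (1 / real (Suc n))))"
      using contra by blast
    then show ?thesis
      unfolding not_eventually
      by (rule frequently_elim1) (auto simp: R_def not_le mult.commute split: prod.splits)
  qed
  from frequently_good_sequence[of R, OF this eventually_True]
  obtain K p x where K: "0 \<le> K" and p: "good_seq K p" and x: "x \<longlonglongrightarrow> xb"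
    and R: "\<And>n. R n (p n, x n)"
    by blast
  define d where "d = (\<lambda>k. res (p k) (x k))"
  define t where "t = (\<lambda>k. shift (p k) + norm (x k - xb))"
  have d_t: "d k < 1 / real (Suc k) * t k" for k using R[of k] by (simp add: R_def d_def t_def)
  have far: "real (Suc k) * d k < dist (x k) \<xi>" if "g (p k) \<xi> \<in> C1 \<times> C2" for k \<xi>
    using R[of k] that by (simp add: R_def d_def)
  have d_pos: "0 < d k" for k
  proof -
    have "d k \<noteq> 0"
    proof
      assume "d k = 0"
      then have "g (p k) (x k) \<in> C1 \<times> C2" by (simp only: d_def res_eq_0)
      from far[OF this] \<open>d k = 0\<close> show False by simp
    qed
    then show ?thesis using res_nonneg[of "p k" "x k"] by (simp add: d_def)
  qed
  have t_pos: "0 < t k" for k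
  proof -
    have "0 < 1 / real (Suc k) * t k" using d_pos[of k] d_t[of k] by linarith
    then show ?thesis by (rule zero_less_mult_pos) simp
  qed
  \<comment> \<open>For \<open>r = d / s\<close> the ratio \<open>d / r\<close> equals
    \<open>s\<close> and vanishes. The root bounds \<open>r / t\<close> by
    \<open>sqrt (d / t)\<close>; the other summand keeps \<open>r k\<close> at most
    \<open>Suc k * d k\<close>, a range without feasible points.\<close>
  define s where "s = (\<lambda>k. 1 / real (Suc k) + sqrt (d k / t k))"
  have q0: "(\<lambda>k. d k / t k) \<longlonglongrightarrow> 0"
  proof (rule LIMSEQ_of_less_inverse_Suc)
    show "norm (d k / t k - 0) < 1 / real (Suc k)" for k
      using d_t[of k] d_pos[of k] t_pos[of k] by (simp add: field_simps)
  qed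
  have sq0: "(\<lambda>k. sqrt (d k / t k)) \<longlonglongrightarrow> 0"
    using tendsto_real_sqrt[OF q0] by simp
  have s0: "s \<longlonglongrightarrow> 0"
    using tendsto_add[OF LIMSEQ_Suc[OF lim_1_over_n] sq0] by (simp add: s_def)
  have sq_pos: "0 < sqrt (d k / t k)" for k using d_pos[of k] t_pos[of k] by simp
  have s_pos: "0 < s k" for k
    unfolding s_def using sq_pos[of k] by (intro add_pos_pos) auto
  define r where "r = (\<lambda>k. d k / s k)"
  show False
  proof (rule no_critical_sequence[OF K p x])
    show "t k = shift (p k) + norm (x k - xb)" for k by (simp add: t_def)
    show "0 < r k" for k using d_pos[of k] s_pos[of k] by (simp add: r_def)
    have "res (p k) (x k) / r k = s k" for k using d_pos[of k] by (simp add: r_def d_def)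
    then show "(\<lambda>k. res (p k) (x k) / r k) \<longlonglongrightarrow> 0" using s0 by simp
    show "(\<lambda>k. r k / t k) \<longlonglongrightarrow> 0"
    proof (rule Lim_null_comparison[OF _ sq0], intro always_eventually allI)
      fix k
      have "norm (r k / t k) = (d k / t k) / s k"
        using d_pos[of k] t_pos[of k] s_pos[of k] by (simp add: r_def)
      also have "\<dots> \<le> (d k / t k) / sqrt (d k / t k)"
        using d_pos[of k] t_pos[of k] by (intro divide_left_mono mult_pos_pos s_pos sq_pos) (auto simp: s_def)
      also have "\<dots> = sqrt (d k / t k)"
        using d_pos[of k] t_pos[of k] by (intro real_div_sqrt) simp
      finally show "norm (r k / t k) \<le> sqrt (d k / t k)" .
    qed
    show "g (p k) \<xi> \<notin> C1 \<times> C2" if "\<xi> \<in> cball (x k) (r k)" for k \<xi>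
    proof
      assume "g (p k) \<xi> \<in> C1 \<times> C2"
      then have "real (Suc k) * d k < r k" using far[of k \<xi>] that by simp
      also have "r k \<le> d k / (1 / real (Suc k))"
        unfolding r_def using d_pos[of k] sq_pos[of k]
        by (intro divide_left_mono mult_pos_pos s_pos) (auto simp: s_def)
      finally show False by (simp add: mult.commute)
    qed
  qed
qed

text \<open>Here (a) enters. Along counterexamples the residual dominates \<open>t\<close>, so a
  feasible point at distance \<open>O(t)\<close> from \<open>x\<close> is already a contradiction;
  (a) and \<open>local_estimate\<close> produce one.\<close>

lemma linear_estimate:
  assumes a: "\<And>v t. v \<in> img_deriv g Dg \<zeta> pb xb \<Longrightarrow> (\<And>k. 0 < (t :: nat \<Rightarrow> real) k) \<Longrightarrow> decseq t \<Longrightarrow>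
    t \<longlonglongrightarrow> 0 \<Longrightarrow>
    \<exists>u. liminf (\<lambda>k. ereal (infdist (g pb xb + t k *\<^sub>R (v + Dg pb xb u)) (C1 \<times> C2) / t k)) = 0"
  shows "\<exists>\<kappa>\<ge>0. \<forall>\<^sub>F (p, x) in nhds pb \<times>\<^sub>F nhds xb. \<exists>\<xi>. g p \<xi> \<in> C1 \<times> C2 \<and> dist x \<xi> \<le> \<kappa> * res p x"
proof (rule ccontr)
  assume contra: "\<not> ?thesis"
  define R where "R = (\<lambda>n (p, x). \<forall>\<xi>. g p \<xi> \<in> C1 \<times> C2 \<longrightarrow> real (Suc n) * res p x < dist x \<xi>)"
  have fr: "\<exists>\<^sub>F z in nhds pb \<times>\<^sub>F nhds xb. R n z" for n
  proof -
    have "\<not> (\<forall>\<^sub>F (p, x) in nhds pb \<times>\<^sub>F nhds xb. \<exists>\<xi>. g p \<xi> \<in> C1 \<times> C2 \<and> dist x \<xi> \<le> real (Suc n) * res p x)"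
      using contra of_nat_0_le_iff by blast
    then show ?thesis
      unfolding not_eventually
      by (rule frequently_elim1) (auto simp: R_def not_le split: prod.splits)
  qed
  obtain c where c: "0 < c" and est: "\<forall>\<^sub>F (p, x) in nhds pb \<times>\<^sub>F nhds xb.
     res p x < c * (shift p + norm (x - xb)) \<longrightarrow>
     (\<exists>\<xi>. g p \<xi> \<in> C1 \<times> C2 \<and> dist x \<xi> \<le> res p x / c)"
    using local_estimate by blast
  obtain K p x where K: "0 \<le> K" and p: "good_seq K p" and x: "x \<longlonglongrightarrow> xb"
    and R: "\<And>n. R n (p n, x n)"
    and est': "\<And>\<psi> y. y \<longlonglongrightarrow> xb \<Longrightarrow> \<forall>\<^sub>F n in sequentially.
      res (p (\<psi> n)) (y n) < c * (shift (p (\<psi> n)) + norm (y n - xb)) \<longrightarrow>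
      (\<exists>\<xi>. g (p (\<psi> n)) \<xi> \<in> C1 \<times> C2 \<and> dist (y n) \<xi> \<le> res (p (\<psi> n)) (y n) / c)"
    using frequently_good_sequence[of R, OF fr est] unfolding case_prod_conv by blast
  define d where "d = (\<lambda>k. res (p k) (x k))"
  define t where "t = (\<lambda>k. shift (p k) + norm (x k - xb))"
  have d0: "0 \<le> d k" for k by (simp add: d_def res_nonneg)
  have far: "real (Suc k) * d k < dist (x k) \<xi>" if "g (p k) \<xi> \<in> C1 \<times> C2" for k \<xi>
    using R[of k] that by (simp add: R_def d_def)
  have large: "\<forall>\<^sub>F k in sequentially. B \<le> real (Suc k)" for B
    using eventually_ge_at_top[of "nat \<lceil>B\<rceil>"] by eventually_elim linarith
  have "\<forall>\<^sub>F k in sequentially. c * t k \<le> d k \<and> 0 < shift (p k)"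
    using est'[OF x, of id, unfolded id_def] large[of "1 / c"]
  proof eventually_elim
    case (elim k)
    have ge: "1 / c * d k \<le> real (Suc k) * d k"
      using elim(2) d0[of k] by (rule mult_right_mono)
    have dt: "c * t k \<le> d k"
    proof (rule ccontr)
      assume "\<not> c * t k \<le> d k"
      then obtain \<xi> where "g (p k) \<xi> \<in> C1 \<times> C2" "dist (x k) \<xi> \<le> d k / c"
        using elim(1) unfolding d_def t_def not_le by metis
      then show False using far[of k \<xi>] ge by simp
    qed
    \<comment> \<open>With zero shift, \<open>xb\<close> itself would be feasible, at distance
      \<open>t k\<close>, which is at most \<open>d k / c\<close>.\<close>
    moreover have "shift (p k) \<noteq> 0"
    proof
      assume s: "shift (p k) = 0"
      then have "g (p k) xb \<in> C1 \<times> C2" using gph by (simp add: shift_def)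
      then have "real (Suc k) * d k < t k" using far[of k xb] s by (simp add: t_def dist_norm)
      moreover have "t k \<le> 1 / c * d k" using dt c by (simp add: field_simps)
      ultimately show False using ge by simp
    qed
    ultimately show ?case using shift_nonneg[of "p k"] by simp
  qed
  then obtain N where N: "\<And>k. k \<ge> N \<Longrightarrow> c * t k \<le> d k \<and> 0 < shift (p k)"
    unfolding eventually_sequentially by blast
  have "bounded (range (\<lambda>k. sgn (g (p (k + N)) xb - g pb xb)))"
    by (intro boundedI[of _ 1]) (auto simp: norm_sgn)
  then obtain v \<phi>1 where \<phi>1: "strict_mono \<phi>1"
    "((\<lambda>k. sgn (g (p (k + N)) xb - g pb xb)) \<circ> \<phi>1) \<longlonglongrightarrow> v"
    using bounded_imp_convergent_subsequence by blast
  define s where "s = (\<lambda>k. shift (p (\<phi>1 k + N)))"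
  have mono1: "strict_mono (\<lambda>k. \<phi>1 k + N)" using \<phi>1(1) by (simp add: strict_mono_def)
  have s: "\<And>k. 0 < s k" "s \<longlonglongrightarrow> 0"
    using N LIMSEQ_subseq_LIMSEQ[OF good_seq_shift[OF p] mono1] by (simp_all add: s_def o_def)
  \<comment> \<open>A second extraction, since (a) is stated for decreasing step lengths.\<close>
  obtain \<phi>2 where \<phi>2: "strict_mono \<phi>2" "decseq (s \<circ> \<phi>2)"
    using decreasing_subsequence[OF s] .
  define \<psi> where "\<psi> = (\<lambda>k. \<phi>1 (\<phi>2 k) + N)"
  have \<psi>: "strict_mono \<psi>" using mono1 \<phi>2(1) by (simp add: \<psi>_def strict_mono_def)
  define P where "P = (\<lambda>k. p (\<psi> k))"
  define T where "T = (\<lambda>k. shift (P k))"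
  have P: "good_seq K P" unfolding P_def by (rule good_seq_subseq[OF p \<psi>])
  have T: "\<And>k. 0 < T k" "T \<longlonglongrightarrow> 0" "decseq T"
    using s(1) \<phi>2(2) good_seq_shift[OF P] by (simp_all add: T_def P_def \<psi>_def s_def o_def)
  have v: "(\<lambda>k. (1 / T k) *\<^sub>R (g (P k) xb - g pb xb)) \<longlonglongrightarrow> v"
    using LIMSEQ_subseq_LIMSEQ[OF \<phi>1(2) \<phi>2(1)]
    by (simp add: o_def T_def P_def \<psi>_def shift_def sgn_div_norm inverse_eq_divide)
  obtain u where u: "liminf (\<lambda>k. ereal (infdist (g pb xb + T k *\<^sub>R (v + A u)) (C1 \<times> C2) / T k)) = 0"
    using a[OF img_deriv_limit[OF P T(1) v] T(1) T(3) T(2)] by blast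
  \<comment> \<open>This is the comparison point: there \<open>g (P k)\<close> agrees with the
    linear model of (a) up to an error that is negligible at scale \<open>T k\<close>.\<close>
  define y where "y = (\<lambda>k. xb + T k *\<^sub>R u)"
  have y: "y \<longlonglongrightarrow> xb"
    using tendsto_add[OF tendsto_const[of xb] tendsto_scaleR[OF T(2) tendsto_const[of u]]]
    by (simp add: y_def)
  have yu: "(1 / T k) *\<^sub>R (y k - xb) = u" for k using T(1)[of k] by (simp add: y_def)
  have rem: "(\<lambda>k. (1 / T k) *\<^sub>R (g (P k) (y k) - (g pb xb + T k *\<^sub>R (v + A u)))) \<longlonglongrightarrow> 0"
  proof -
    have "(1 / T k) *\<^sub>R (g (P k) (y k) - (g pb xb + T k *\<^sub>R (v + A u))) =
        (1 / T k) *\<^sub>R (g (P k) (y k) - g (P k) xb - A (y k - xb))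
        + ((1 / T k) *\<^sub>R (g (P k) xb - g pb xb) - v)" for k
    proof -
      have "A (y k - xb) = T k *\<^sub>R A u" by (simp add: y_def blinfun.scaleR_right)
      moreover have "(1 / T k) *\<^sub>R (T k *\<^sub>R z) = z" for z :: "'b \<times> 'c" using T(1)[of k] by simp
      ultimately show ?thesis by (simp add: scaleR_diff_right scaleR_add_right)
    qed
    then show ?thesis
      using tendsto_add[OF good_seq_remainder[OF P y T(1), where u = u] LIM_zero[OF v]] yu by simp
  qed
  \<comment> \<open>A zero \<open>liminf\<close> gives smallness only for infinitely many
    \<open>k\<close>, which is enough because the other bounds hold eventually. Half of
    \<open>c\<close> goes to this distance and half to the model error.\<close>
  have freq: "\<exists>\<^sub>F k in sequentially. infdist (g pb xb + T k *\<^sub>R (v + A u)) (C1 \<times> C2) / T k < c / 2"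
  proof (rule ccontr)
    assume "\<not> ?thesis"
    then have "\<forall>\<^sub>F k in sequentially. ereal (c / 2) \<le> ereal (infdist (g pb xb + T k *\<^sub>R (v + A u)) (C1 \<times> C2) / T k)"
      by (simp add: not_frequently not_less)
    from Liminf_bounded[OF this] show False using u c by simp
  qed
  have "\<forall>\<^sub>F k in sequentially. norm ((1 / T k) *\<^sub>R (g (P k) (y k) - (g pb xb + T k *\<^sub>R (v + A u)))) < c / 2"
    using order_tendstoD(2)[OF tendsto_norm_zero[OF rem], of "c / 2"] c by simp
  moreover have "\<forall>\<^sub>F k in sequentially. res (P k) (y k) < c * (T k + norm (y k - xb)) \<longrightarrow>
      (\<exists>\<xi>. g (P k) \<xi> \<in> C1 \<times> C2 \<and> dist (y k) \<xi> \<le> res (P k) (y k) / c)"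
    using est'[OF y, of \<psi>] by (simp add: P_def T_def)
  \<comment> \<open>The threshold anticipates the route from \<open>x\<close> through
    \<open>xb\<close> and \<open>y\<close> to the feasible point: its length is at most
    \<open>(2 + norm u) * t\<close>, hence at most \<open>(2 + norm u) / c\<close> times the
    residual at \<open>x\<close>.\<close>
  moreover have "\<forall>\<^sub>F k in sequentially. (2 + norm u) / c \<le> real (Suc (\<psi> k))"
    using eventually_subseq[OF \<psi> large] .
  ultimately have "\<exists>\<^sub>F k in sequentially. False"
  proof (rule frequently_rev_mp[OF freq, OF eventually_mono[OF eventually_conj[OF _ eventually_conj]]])
    fix k
    assume H: "norm ((1 / T k) *\<^sub>R (g (P k) (y k) - (g pb xb + T k *\<^sub>R (v + A u)))) < c / 2 \<and>
      (res (P k) (y k) < c * (T k + norm (y k - xb)) \<longrightarrow>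
        (\<exists>\<xi>. g (P k) \<xi> \<in> C1 \<times> C2 \<and> dist (y k) \<xi> \<le> res (P k) (y k) / c)) \<and>
      (2 + norm u) / c \<le> real (Suc (\<psi> k))"
    show "infdist (g pb xb + T k *\<^sub>R (v + A u)) (C1 \<times> C2) / T k < c / 2 \<longrightarrow> False"
    proof
      assume i: "infdist (g pb xb + T k *\<^sub>R (v + A u)) (C1 \<times> C2) / T k < c / 2"
      have "norm (g (P k) (y k) - (g pb xb + T k *\<^sub>R (v + A u))) < c / 2 * T k"
        using conjunct1[OF H, unfolded norm_scaleR] T(1)[of k] by (simp add: field_simps)
      moreover have "infdist (g pb xb + T k *\<^sub>R (v + A u)) (C1 \<times> C2) < c / 2 * T k"
        using i T(1)[of k] by (simp add: field_simps)
      moreover have "res (P k) (y k) \<le> infdist (g pb xb + T k *\<^sub>R (v + A u)) (C1 \<times> C2)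
          + norm (g (P k) (y k) - (g pb xb + T k *\<^sub>R (v + A u)))"
        unfolding res_def using infdist_triangle by (metis dist_norm)
      ultimately have res: "res (P k) (y k) < c * T k" by (simp add: field_simps)
      also have "\<dots> \<le> c * (T k + norm (y k - xb))" using c by (intro mult_left_mono) auto
      finally obtain \<xi> where \<xi>: "g (P k) \<xi> \<in> C1 \<times> C2" "dist (y k) \<xi> \<le> res (P k) (y k) / c"
        using H by metis
      have "dist (y k) \<xi> \<le> T k"
        using \<xi>(2) res c by (smt (verit) divide_less_eq mult.commute)
      moreover have "dist xb (y k) = T k * norm u" using T(1)[of k] by (simp add: y_def dist_norm)
      ultimately have "dist (x (\<psi> k)) \<xi> \<le> norm (x (\<psi> k) - xb) + T k * norm u + T k"
        using dist_triangle[of "x (\<psi> k)" \<xi> xb] dist_triangle[of xb \<xi> "y k"] by (simp add: dist_norm)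
      also have "\<dots> \<le> (2 + norm u) * t (\<psi> k)"
      proof -
        have le: "T k \<le> t (\<psi> k)" "norm (x (\<psi> k) - xb) \<le> t (\<psi> k)"
          using shift_nonneg by (simp_all add: t_def T_def P_def)
        then have "T k * norm u \<le> t (\<psi> k) * norm u" by (intro mult_right_mono) auto
        then show ?thesis using le by (simp add: algebra_simps)
      qed
      also have "\<dots> \<le> (2 + norm u) * (d (\<psi> k) / c)"
        using N[of "\<psi> k"] c by (intro mult_left_mono) (auto simp: \<psi>_def field_simps)
      also have "\<dots> = (2 + norm u) / c * d (\<psi> k)" by simp
      also have "\<dots> \<le> real (Suc (\<psi> k)) * d (\<psi> k)" using H d0 by (intro mult_right_mono) auto
      finally show False using far[of "\<psi> k" \<xi>] \<xi>(1) by (simp add: P_def)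
    qed
  qed
  then show False by simp
qed

end

section \<open>From the product filter to neighbourhoods\<close>

theorem theorem3p5:
  fixes g :: "'p::topological_space \<Rightarrow> real^'n \<Rightarrow> ((real^'m) \<times> (real^'k))"
    and Dg :: "'p \<Rightarrow> real^'n \<Rightarrow> ((real^'n) \<Rightarrow>\<^sub>L ((real^'m) \<times> (real^'k)))"
    and C1 :: "(real^'m) set" and C2 :: "(real^'k) set"
    and \<zeta> :: "'p \<Rightarrow> real" and pb :: 'p and xb :: "real^'n"
  assumes closed1: "closed C1" and closed2: "closed C2"
    and gph: "g pb xb \<in> C1 \<times> C2"
    and standing: "standing_assumptions g Dg pb xb"
    and zeta_cont: "(\<zeta> \<longlongrightarrow> \<zeta> pb) (at pb)"
    and a: "\<forall>v\<in>img_deriv g Dg \<zeta> pb xb. \<forall>t::nat \<Rightarrow> real.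
              (\<forall>k. 0 < t k) \<and> decseq t \<and> t \<longlonglongrightarrow> 0 \<longrightarrow>
              (\<exists>u. liminf (\<lambda>k. ereal (infdist (g pb xb + t k *\<^sub>R (v + Dg pb xb u)) (C1 \<times> C2) / t k)) = 0)"
    and b: "robinson_stable (\<lambda>p x. snd (g p x)) C2 pb xb"
    and c: "\<forall>v\<in>img_deriv g Dg \<zeta> pb xb. \<forall>u.
              (v, u) \<noteq> (0, 0) \<and> v + Dg pb xb u \<in> contingent_cone (C1 \<times> C2) (g pb xb) \<longrightarrow>
              (\<forall>lam1 lam2.
                 lam1 \<in> dir_normal_cone C1 (fst (g pb xb)) (fst v + fst (Dg pb xb u)) \<and>
                 lam2 \<in> dir_normal_cone C2 (snd (g pb xb)) (snd v + snd (Dg pb xb u)) \<and>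
                 adjoint (blinfun_apply (Dg pb xb)) (lam1, lam2) = 0
                 \<longrightarrow> lam1 = 0)"
  shows "robinson_stable g (C1 \<times> C2) pb xb"
proof -
  interpret split_system g Dg C1 C2 \<zeta> pb xb
    using closed1 closed2 gph standing zeta_cont b c by unfold_locales blast+
  obtain \<kappa> where \<kappa>: "0 \<le> \<kappa>"
    "\<forall>\<^sub>F (p, x) in nhds pb \<times>\<^sub>F nhds xb. \<exists>\<xi>. g p \<xi> \<in> C1 \<times> C2 \<and> dist x \<xi> \<le> \<kappa> * res p x"
    using linear_estimate a by blast
  then obtain P Q where PQ: "eventually P (nhds pb)" "eventually Q (nhds xb)"
    "\<And>p x. P p \<Longrightarrow> Q x \<Longrightarrow> \<exists>\<xi>. g p \<xi> \<in> C1 \<times> C2 \<and> dist x \<xi> \<le> \<kappa> * res p x"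
    unfolding eventually_prod_filter case_prod_conv by metis
  obtain V where V: "open V" "pb \<in> V" "\<And>p. p \<in> V \<Longrightarrow> P p"
    using PQ(1) unfolding eventually_nhds by metis
  obtain U where U: "open U" "xb \<in> U" "\<And>x. x \<in> U \<Longrightarrow> Q x"
    using PQ(2) unfolding eventually_nhds by metis
  \<comment> \<open>An actual feasible point yields the distance bound and also settles the
    nonemptiness clause of \<open>robinson_stable\<close>.\<close>
  have "{\<xi>. g p \<xi> \<in> C1 \<times> C2} \<noteq> {} \<and>
      infdist x {\<xi>. g p \<xi> \<in> C1 \<times> C2} \<le> \<kappa> * infdist (g p x) (C1 \<times> C2)"
    if px: "p \<in> V" "x \<in> U" for p x
  proof -
    obtain \<xi> where \<xi>: "\<xi> \<in> {\<xi>. g p \<xi> \<in> C1 \<times> C2}" "dist x \<xi> \<le> \<kappa> * infdist (g p x) (C1 \<times> C2)"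
      using PQ(3)[OF V(3) U(3), OF px] unfolding res_def mem_Collect_eq by metis
    then show ?thesis using infdist_le2[OF \<xi>] by (metis empty_iff)
  qed
  then show ?thesis
    unfolding robinson_stable_def using \<kappa>(1) U(1,2) V(1,2) by metis
qed

end
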